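(* Let $K$ be a field of any characteristic, $x=(x_1,\ldots,x_n)$, and let $H\in K[x]^n$ be a quadratic polynomial map in dimension $n$ over $K$, such that $\operatorname{rk}\mathcal{J}H\le 2$ and $\mathcal{J}H$ is nilpotent. Then $\mathcal{J}H$ is similar over $K$ to a triangular matrix.
   Context: The degree of $H=(H_1,\ldots,H_n)$ is $\max_i\deg H_i$; quadratic means of degree at most $2$. $\mathcal{J}H=\left(\frac{\partial H_i}{\partial x_j}\right)_{i,j}\in\operatorname{Mat}_n(K[x])$ is the Jacobian matrix, with rank taken over $K(x)$. A square matrix $M$ is nilpotent if $M^r=0$ for some $r\ge1$. Matrices $M,\tilde M\in\operatorname{Mat}_n(K[x])$ are similar over $K$ if there is $T\in\operatorname{GL}_n(K)$ (with entries in $K$) such that $\tilde M=T^{-1}MT$. A matrix is triangular if it is upper triangular or lower triangular. *)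

theory Defs
  imports
    "HOL-Analysis.Analysis"
    "HOL-Library.Poly_Mapping"
    "HOL-Computational_Algebra.Fraction_Field"
begin

text \<open>
  Monomials are exponent vectors and a polynomial is the finitely supported map sending each
  monomial to its coefficient. With a finite index type of cardinality n this is exactly
  K[x_1,...,x_n]; the linear order on the index type gives the variables (and the rows and
  columns of matrices) their order x_1 < ... < x_n. The product is the convolution product.
\<close>

type_synonym ('n, 'a) mpoly = "('n \<Rightarrow>\<^sub>0 nat) \<Rightarrow>\<^sub>0 'a"

definition Const :: "'a::zero \<Rightarrow> ('n, 'a) mpoly"
  where "Const c = Poly_Mapping.single 0 c"

definition monom_degree :: "('n::finite \<Rightarrow>\<^sub>0 nat) \<Rightarrow> nat"
  where "monom_degree m = (\<Sum>i\<in>UNIV. Poly_Mapping.lookup m i)"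

text \<open>The zero polynomial gets degree 0; this convention is harmless for upper bounds.\<close>

definition total_degree :: "('n::finite, 'a::zero) mpoly \<Rightarrow> nat"
  where "total_degree p = Max (insert 0 (monom_degree ` Poly_Mapping.keys p))"

definition map_degree :: "(('n::finite, 'a::zero) mpoly)^'n \<Rightarrow> nat"
  where "map_degree H = Max (range (\<lambda>i. total_degree (H $ i)))"

text \<open>
  The formal partial derivative, defined term by term. The truncated subtraction of exponents
  only occurs in terms whose coefficient is zero.
\<close>

definition partial_deriv :: "'n \<Rightarrow> ('n, 'a::semiring_1) mpoly \<Rightarrow> ('n, 'a) mpoly"
  where "partial_deriv j p =
    (\<Sum>m\<in>Poly_Mapping.keys p.
       Poly_Mapping.single (m - Poly_Mapping.single j 1)
         (of_nat (Poly_Mapping.lookup m j) * Poly_Mapping.lookup p m))"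

definition jacobian_matrix :: "(('n::finite, 'a::semiring_1) mpoly)^'n \<Rightarrow> (('n, 'a) mpoly)^'n^'n"
  where "jacobian_matrix H = (\<chi> i j. partial_deriv j (H $ i))"

text \<open>The rank over the field of fractions; for entries in K[x] this field is K(x).\<close>

definition fract_rank :: "('r::idom)^'n^'m \<Rightarrow> nat"
  where "fract_rank M = rank (map_matrix (\<lambda>p. Fract p 1) M)"

text \<open>The library's power operator on this matrix type is the entrywise power.\<close>

primrec matrix_power :: "('r::semiring_1)^'n^'n \<Rightarrow> nat \<Rightarrow> 'r^'n^'n"
  where
    "matrix_power M 0 = mat 1"
  | "matrix_power M (Suc r) = M ** matrix_power M r"

definition nilpotent_matrix :: "('r::semiring_1)^'n^'n \<Rightarrow> bool"
  where "nilpotent_matrix M \<longleftrightarrow> (\<exists>r\<ge>1. matrix_power M r = 0)"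

definition similar_over_base ::
  "(('n::finite, 'a::field) mpoly)^'n^'n \<Rightarrow> (('n, 'a) mpoly)^'n^'n \<Rightarrow> bool"
  where "similar_over_base M M' \<longleftrightarrow>
    (\<exists>T::'a^'n^'n. invertible T \<and>
       M' = map_matrix Const (matrix_inv T) ** M ** map_matrix Const T)"

definition upper_triangular_matrix :: "('r::zero)^('n::{finite,linorder})^('n::{finite,linorder}) \<Rightarrow> bool"
  where "upper_triangular_matrix M \<longleftrightarrow> (\<forall>i j. j < i \<longrightarrow> M $ i $ j = 0)"

definition lower_triangular_matrix :: "('r::zero)^('n::{finite,linorder})^('n::{finite,linorder}) \<Rightarrow> bool"
  where "lower_triangular_matrix M \<longleftrightarrow> (\<forall>i j. i < j \<longrightarrow> M $ i $ j = 0)"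

definition triangular_matrix :: "('r::zero)^('n::{finite,linorder})^('n::{finite,linorder}) \<Rightarrow> bool"
  where "triangular_matrix M \<longleftrightarrow> upper_triangular_matrix M \<or> lower_triangular_matrix M"

end

theory Submission
  imports Defs
begin

text \<open>
  Since the map is quadratic, its Jacobian matrix is \<open>A0 + B x\<close> with \<open>B x y\<close> bilinear, and equality
  of mixed derivatives makes \<open>B\<close> symmetric. Over the infinite field \<open>K(t)\<close> the linear family
  \<open>s A0 + B x\<close> consists of nilpotent maps of rank at most two. Such a family has a common kernel vector:
  if some member \<open>N\<close> has rank two, perturbing it to \<open>N + t M\<close> shows that a common kernel vector exists
  or that a hyperplane is mapped into a line by the whole family (as for the compression spaces
  in Atkinson's classification), and in the latter case the symmetry of \<open>B\<close> yields the vector.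
  Symmetry passes to the quotient by an invariant subspace, so long products of coefficient
  matrices vanish. This property descends to \<open>K\<close>, where it produces a basis that triangularizes all
  coefficient matrices at once.
\<close>

subsection \<open>Limits of dependent triples and families of rank one\<close>


text \<open>Two obstacles shape the proof. The field \<open>K\<close> may be finite, while the
  perturbation arguments let \<open>t\<close> tend to 0. Without a topology, dependence of three
  vectors is encoded by determinants of functionals: these are polynomials in \<open>t\<close>, so
  vanishing for all \<open>t \<noteq> 0\<close> in an infinite field gives vanishing at 0. The
  characteristic may be 2 or 3, so no identity is polarized by dividing; coefficients of powers of
  \<open>t\<close> are compared instead. Rank at most two bounds the nilpotency index by 3, which is
  why only cubes occur. The first candidate for the common kernel vector is \<open>N a\<close>,
  chosen in both the image and the kernel of a member \<open>N\<close> of rank two.\<close>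

definition det3 :: "'a::comm_ring_1 \<Rightarrow> 'a \<Rightarrow> 'a \<Rightarrow> 'a \<Rightarrow> 'a \<Rightarrow> 'a \<Rightarrow> 'a \<Rightarrow> 'a \<Rightarrow> 'a \<Rightarrow> 'a"
  where "det3 a b c d e f g h i = a * (e * i - f * h) - b * (d * i - f * g) + c * (d * h - e * g)"

lemma poly_eq_0_of_infinite:
  fixes p :: "'a::field poly"
  assumes "infinite (UNIV :: 'a set)" "\<And>t. t \<noteq> 0 \<Longrightarrow> poly p t = 0"
  shows "p = 0"
proof (rule ccontr)
  assume "p \<noteq> 0"
  then have "finite (insert 0 {t. poly p t = 0})"
    by (simp add: poly_roots_finite)
  moreover have "insert 0 {t. poly p t = 0} = UNIV"
    using assms(2) by blast
  ultimately show False using assms(1) by simp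
qed

text \<open>The determinant is a polynomial in \<open>t\<close> with infinitely many roots, hence
  the zero polynomial. This replaces a topological limit.\<close>

lemma det3_limit:
  fixes a b c d e f g h i :: "'a::field"
  assumes inf: "infinite (UNIV :: 'a set)"
    and 0: "\<And>t. t \<noteq> 0 \<Longrightarrow>
      det3 (a + t * a') (b + t * b') (c + t * c') (d + t * d') (e + t * e') (f + t * f')
        (g + t * g') (h + t * h') (i + t * i') = 0"
  shows "det3 a b c d e f g h i = 0"
proof -
  let ?p = "det3 [:a, a':] [:b, b':] [:c, c':] [:d, d':] [:e, e':] [:f, f':] [:g, g':] [:h, h':] [:i, i':]"
  have p: "poly ?p t = det3 (a + t * a') (b + t * b') (c + t * c') (d + t * d') (e + t * e') (f + t * f')
        (g + t * g') (h + t * h') (i + t * i')" for t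
    by (simp add: det3_def del: mult_pCons_left mult_pCons_right)
  have "?p = 0"
    by (rule poly_eq_0_of_infinite[OF inf]) (simp add: p 0)
  then have "poly ?p 0 = 0" by simp
  then show ?thesis unfolding p by simp
qed

locale infinite_field_space = vector_space scale
  for scale :: "'a::field \<Rightarrow> 'b::ab_group_add \<Rightarrow> 'b" (infixr \<open>\<cdot>\<close> 75) +
  assumes infinite_field: "infinite (UNIV :: 'a set)"
begin

lemma separating_functional:
  assumes "subspace R" "v \<notin> R"
  obtains f where "Vector_Spaces.linear scale (*) f" "f v = 1" "\<And>r. r \<in> R \<Longrightarrow> f r = 0"
proof -
  interpret fp: vector_space_pair scale "(*) :: 'a \<Rightarrow> 'a \<Rightarrow> 'a"
    by unfold_locales
  obtain B where B: "B \<subseteq> R" "independent B" "R \<subseteq> span B"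
    using maximal_independent_subset by blast
  have "span B = R" using B assms(1) span_minimal by blast
  then have "independent (insert v B)"
    using independent_insertI B(2) assms(2) by blast
  from fp.linear_independent_extend[OF this, of "\<lambda>x. if x = v then 1 else 0"]
  obtain f where f: "Vector_Spaces.linear scale (*) f"
    "\<forall>x\<in>insert v B. f x = (if x = v then 1 else 0)" by auto
  have z: "f b = 0" if "b \<in> B" for b
    using that f(2) B(1) assms(2) by auto
  have "f r = 0" if "r \<in> R" for r
    using fp.linear_eq_0_on_span[OF f(1) z, of B r] that B(3) by blast
  then show thesis using that f by auto
qed

text \<open>Linear dependence tested by functionals: unlike a statement about spans, it is a system
  of polynomial equations and survives limits.\<close>

definition dep3 :: "'b \<Rightarrow> 'b \<Rightarrow> 'b \<Rightarrow> bool" where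
  "dep3 x y z \<longleftrightarrow> (\<forall>f1 f2 f3. Vector_Spaces.linear scale (*) f1 \<longrightarrow> Vector_Spaces.linear scale (*) f2
      \<longrightarrow> Vector_Spaces.linear scale (*) f3
    \<longrightarrow> det3 (f1 x) (f2 x) (f3 x) (f1 y) (f2 y) (f3 y) (f1 z) (f2 z) (f3 z) = 0)"

lemma functional_simps:
  assumes "Vector_Spaces.linear scale (*) f"
  shows "f (x + y) = f x + f y" "f (c \<cdot> x) = c * f x" "f 0 = 0"
proof -
  interpret Vector_Spaces.linear scale "(*)" f by fact
  show "f (x + y) = f x + f y" "f (c \<cdot> x) = c * f x" "f 0 = 0"
    by (simp_all add: add scale)
qed

text \<open>Functionals adapted to an independent triple make the matrix triangular with ones on the
  diagonal, so its determinant is 1.\<close>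

lemma dep3_cases:
  fixes x y z :: 'b
  assumes "dep3 x y z" "x \<noteq> 0" "y \<notin> span {x}"
  shows "z \<in> span {x, y}"
proof (rule ccontr)
  assume z: "z \<notin> span {x, y}"
  obtain f1 where f1: "Vector_Spaces.linear scale (*) f1" "f1 x = 1"
    using separating_functional[of "{0}" x] assms(2) by auto
  obtain f2 where f2: "Vector_Spaces.linear scale (*) f2" "f2 y = 1" "f2 x = 0"
    using separating_functional[of "span {x}" y] assms(3) subspace_span
    by (metis singletonI span_base)
  obtain f3 where f3: "Vector_Spaces.linear scale (*) f3" "f3 z = 1" "f3 x = 0" "f3 y = 0"
    using separating_functional[of "span {x, y}" z] z subspace_span
    by (metis insertCI span_base)
  show False
    using assms(1)[unfolded dep3_def, rule_format, OF f1(1) f2(1) f3(1)]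
    by (simp add: det3_def f1 f2 f3)
qed

lemma dep3_cancel:
  assumes "dep3 x y (c \<cdot> z)" "c \<noteq> 0"
  shows "dep3 x y z"
  unfolding dep3_def
proof (intro allI impI)
  fix f1 f2 f3
  assume f: "Vector_Spaces.linear scale (*) f1" "Vector_Spaces.linear scale (*) f2"
    "Vector_Spaces.linear scale (*) f3"
  have "c * det3 (f1 x) (f2 x) (f3 x) (f1 y) (f2 y) (f3 y) (f1 z) (f2 z) (f3 z) = 0"
    using assms(1)[unfolded dep3_def, rule_format, OF f]
    by (simp add: functional_simps[OF f(1)] functional_simps[OF f(2)] functional_simps[OF f(3)]
        det3_def algebra_simps)
  then show "det3 (f1 x) (f2 x) (f3 x) (f1 y) (f2 y) (f3 y) (f1 z) (f2 z) (f3 z) = 0"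
    using assms(2) by simp
qed

lemma dep3_rotate: "dep3 x y z \<Longrightarrow> dep3 y z x"
  unfolding dep3_def det3_def
  by (intro allI impI, drule spec, drule spec, drule spec, drule mp, assumption, drule mp, assumption,
      drule mp, assumption) (simp add: algebra_simps)

lemma dep3_if_dependent2:
  fixes x y z :: 'b
  assumes "x = 0 \<or> y \<in> span {x}"
  shows "dep3 x y z"
  unfolding dep3_def
proof (intro allI impI)
  fix f1 f2 f3
  assume f: "Vector_Spaces.linear scale (*) f1" "Vector_Spaces.linear scale (*) f2"
    "Vector_Spaces.linear scale (*) f3"
  note s = functional_simps[OF f(1)] functional_simps[OF f(2)] functional_simps[OF f(3)]
  from assms show "det3 (f1 x) (f2 x) (f3 x) (f1 y) (f2 y) (f3 y) (f1 z) (f2 z) (f3 z) = 0"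
  proof
    assume "y \<in> span {x}"
    then obtain c where "y = c \<cdot> x" by (auto simp: span_singleton)
    then show ?thesis by (simp add: s det3_def algebra_simps)
  qed (simp add: s det3_def)
qed

lemma dep3_limit:
  assumes dep: "\<And>t. t \<noteq> 0 \<Longrightarrow> dep3 (x + t \<cdot> x') (y + t \<cdot> y') (z + t \<cdot> z')"
  shows "dep3 x y z"
  unfolding dep3_def
proof (intro allI impI)
  fix f1 f2 f3
  assume f: "Vector_Spaces.linear scale (*) f1" "Vector_Spaces.linear scale (*) f2"
    "Vector_Spaces.linear scale (*) f3"
  note s = functional_simps[OF f(1)] functional_simps[OF f(2)] functional_simps[OF f(3)]
  show "det3 (f1 x) (f2 x) (f3 x) (f1 y) (f2 y) (f3 y) (f1 z) (f2 z) (f3 z) = 0"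
  proof (rule det3_limit[OF infinite_field])
    fix t :: 'a assume "t \<noteq> 0"
    show "det3 (f1 x + t * f1 x') (f2 x + t * f2 x') (f3 x + t * f3 x')
      (f1 y + t * f1 y') (f2 y + t * f2 y') (f3 y + t * f3 y')
      (f1 z + t * f1 z') (f2 z + t * f2 z') (f3 z + t * f3 z') = 0"
      using dep[OF \<open>t \<noteq> 0\<close>, unfolded dep3_def, rule_format, OF f] by (simp add: s)
  qed
qed

text \<open>Modulo \<open>R\<close> this is the classical alternative for spaces of maps of rank at
  most one: a common image line or a common kernel of codimension at most one.\<close>

lemma rank_one_family:
  assumes R: "subspace R"
    and add: "\<And>M u v. M \<in> L \<Longrightarrow> M (u + v) = M u + M v"
    and scl: "\<And>M c u. M \<in> L \<Longrightarrow> M (c \<cdot> u) = c \<cdot> M u"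
    and sum: "\<And>M N. M \<in> L \<Longrightarrow> N \<in> L \<Longrightarrow> (\<lambda>u. M u + N u) \<in> L"
    and U: "subspace U"
    and rank: "\<And>M u v. M \<in> L \<Longrightarrow> u \<in> U \<Longrightarrow> v \<in> U \<Longrightarrow> M u \<notin> R \<Longrightarrow> M v \<in> span (insert (M u) R)"
  shows "(\<exists>w. \<forall>M\<in>L. \<forall>u\<in>U. M u \<in> span (insert w R)) \<or>
    (\<exists>x\<in>U. \<forall>u\<in>U. \<exists>c. \<forall>M\<in>L. M (u - c \<cdot> x) \<in> R)"
proof -
  have spR[simp]: "span R = R" using R by (simp add: span_eq_iff)
  \<comment> \<open>If \<open>N k\<close> were nonzero modulo \<open>R\<close>, its line
    \<open>?T\<close> would contain the images of \<open>N\<close> and of \<open>M + N\<close>,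
    because \<open>M k\<close> vanishes modulo \<open>R\<close>. Then it would contain the image of
    \<open>M\<close> too, and the two image lines would coincide.\<close>
  have key: "N k \<in> R"
    if MN: "M \<in> L" "N \<in> L" and U': "x \<in> U" "y \<in> U" "k \<in> U"
      and Mx: "M x \<notin> R" and Ny: "N y \<notin> span (insert (M x) R)" and Mk: "M k \<in> R"
    for M N x y k
  proof (rule ccontr)
    assume Nk: "N k \<notin> R"
    let ?S = "\<lambda>u. M u + N u"
    let ?T = "span (insert (N k) R)"
    have T: "subspace ?T" "R \<subseteq> ?T" "N k \<in> ?T"
      by (auto intro: span_base)
    have "?S k \<notin> R" using Mk Nk R subspace_diff[of R "M k + N k" "M k"] by auto
    then have "?S x \<in> span (insert (?S k) R)"
      using rank[of ?S k x] sum MN U' by blast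
    moreover have "insert (?S k) R \<subseteq> ?T" using T Mk by (auto intro: subspace_add)
    then have "span (insert (?S k) R) \<subseteq> ?T" using T(1) span_minimal by blast
    moreover have "N x \<in> ?T" using rank[of N k x] MN U' Nk by blast
    ultimately have MxT: "M x \<in> ?T"
      using subspace_diff[OF T(1), of "?S x" "N x"] by auto
    have "N k \<in> span (insert (M x) R)"
      using in_span_insert[of "M x" "N k" R] MxT Mx by auto
    then have "?T \<subseteq> span (insert (M x) R)"
      by (intro span_minimal) (auto intro: span_base)
    moreover have "N y \<in> ?T" using rank[of N k y] MN U' Nk by blast
    ultimately show False using Ny by blast
  qed
  show ?thesis
  proof (cases "\<forall>M\<in>L. \<forall>u\<in>U. M u \<in> R")
    case True
    then show ?thesis using spR by (intro disjI1 exI[of _ 0]) (auto intro: span_base)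
  next
    case False
    then obtain M1 x1 where 1: "M1 \<in> L" "x1 \<in> U" "M1 x1 \<notin> R" by blast
    show ?thesis
    proof (cases "\<forall>M\<in>L. \<forall>u\<in>U. M u \<in> span (insert (M1 x1) R)")
      case False
      then obtain M2 x2 where 2: "M2 \<in> L" "x2 \<in> U" "M2 x2 \<notin> span (insert (M1 x1) R)" by blast
      have R2: "M2 x2 \<notin> R" using 2 span_base by blast
      have "\<exists>c. \<forall>M\<in>L. M (u - c \<cdot> x1) \<in> R" if u: "u \<in> U" for u
      proof -
        obtain c where "M1 u - c \<cdot> M1 x1 \<in> R"
          using rank[OF 1(1,2) u 1(3)] by (auto simp: span_breakdown_eq)
        moreover define k where "k = u - c \<cdot> x1"
        moreover have "M1 (u - c \<cdot> x1) = M1 u - c \<cdot> M1 x1"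
          using add[OF 1(1), of "u - c \<cdot> x1" "c \<cdot> x1"] by (simp add: scl[OF 1(1)])
        ultimately have k: "k \<in> U" "M1 k \<in> R"
          using U u 1(2) by (auto intro: subspace_diff subspace_scale)
        have k2: "M2 k \<in> R" by (rule key[OF 1(1) 2(1) 1(2) 2(2) k(1) 1(3) 2(3) k(2)])
        \<comment> \<open>A value \<open>M k\<close> outside \<open>R\<close> would lie on the image
          lines of both \<open>M1\<close> and \<open>M2\<close> modulo \<open>R\<close>, which
          differ.\<close>
        have "M k \<in> R" if M: "M \<in> L" for M
        proof (rule ccontr)
          assume n: "M k \<notin> R"
          have *: "M k \<in> span (insert (M1 x1) R)"
            using key[OF 1(1) M 1(2) k(1) k(1) 1(3) _ k(2)] n by blast
          moreover have **: "M k \<in> span (insert (M2 x2) R)"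
            using key[OF 2(1) M 2(2) k(1) k(1) R2 _ k2] n by blast
          have "M2 x2 \<in> span (insert (M k) R)"
            using in_span_insert[OF **] n by simp
          moreover have "span (insert (M k) R) \<subseteq> span (insert (M1 x1) R)"
            using * by (intro span_minimal) (auto intro: span_base)
          ultimately show False using 2(3) by blast
        qed
        then show ?thesis using k_def by auto
      qed
      then show ?thesis using 1(2) by blast
    qed blast
  qed
qed

end


subsection \<open>Common kernels of nilpotent families of rank at most two\<close>

text \<open>The maps act on a subspace \<open>U\<close> because quotients are later realized as
  ranges of projections. \<open>comb\<close> makes a nonempty \<open>L\<close> a linear
  space.\<close>

locale nilpotent_family = infinite_field_space scale
  for scale :: "'a::field \<Rightarrow> 'b::ab_group_add \<Rightarrow> 'b" (infixr \<open>\<cdot>\<close> 75) +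
  fixes U :: "'b set" and L :: "('b \<Rightarrow> 'b) set"
  assumes subspace_U: "subspace U"
    and add: "M \<in> L \<Longrightarrow> M (u + v) = M u + M v"
    and scl: "M \<in> L \<Longrightarrow> M (c \<cdot> u) = c \<cdot> M u"
    and comb: "M \<in> L \<Longrightarrow> N \<in> L \<Longrightarrow> (\<lambda>u. M u + c \<cdot> N u) \<in> L"
    and into: "M \<in> L \<Longrightarrow> u \<in> U \<Longrightarrow> M u \<in> U"
    and cube: "M \<in> L \<Longrightarrow> u \<in> U \<Longrightarrow> M (M (M u)) = 0"
    and rank: "M \<in> L \<Longrightarrow> u1 \<in> U \<Longrightarrow> u2 \<in> U \<Longrightarrow> u3 \<in> U \<Longrightarrow> dep3 (M u1) (M u2) (M u3)"
begin

lemma zero [simp]: "M \<in> L \<Longrightarrow> M 0 = 0"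
  using scl[of M 0 0] by simp

lemma diff: "M \<in> L \<Longrightarrow> M (u - v) = M u - M v"
  using add[of M u "- v"] scl[of M "- 1" v] by simp

lemma sum2: "M \<in> L \<Longrightarrow> N \<in> L \<Longrightarrow> (\<lambda>u. M u + N u) \<in> L"
  using comb[of M N 1] by simp

lemmas U_closed = subspace_add[OF subspace_U] subspace_diff[OF subspace_U]
  subspace_scale[OF subspace_U] subspace_0[OF subspace_U]

lemma eigen:
  assumes "M \<in> L" "w \<in> U" "M w = c \<cdot> w"
  shows "M w = 0"
proof -
  have "M (M (M w)) = c \<cdot> c \<cdot> c \<cdot> w"
    by (simp add: assms scl)
  then show ?thesis using cube[OF assms(1,2)] assms(3) by auto
qed

lemma eigen_span: "M \<in> L \<Longrightarrow> w \<in> U \<Longrightarrow> M w \<in> span {w} \<Longrightarrow> M w = 0"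
  using eigen by (auto simp: span_singleton)

lemma exists_scalar: "\<exists>c::'a. c \<noteq> 0 \<and> c \<noteq> 1"
proof (rule ccontr)
  assume "\<not> ?thesis"
  then have "UNIV \<subseteq> {0, 1 :: 'a}" by auto
  then show False using infinite_field finite_subset by blast
qed

text \<open>The left side is the coefficient of \<open>t\<close> in the cube of
  \<open>M + t N\<close>. What remains of that cube is \<open>t x + t^2 y = 0\<close>; the values
  \<open>t = 1\<close> and one further \<open>t\<close> outside 0 and 1 force both coefficients to
  vanish.\<close>

lemma cube_polar:
  assumes M: "M \<in> L" and N: "N \<in> L" and u: "u \<in> U"
  shows "M (M (N u)) + M (N (M u)) + N (M (M u)) = 0"
proof -
  define x where "x = M (M (N u)) + M (N (M u)) + N (M (M u))"
  define y where "y = N (N (M u)) + N (M (N u)) + M (N (N u))"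
  have *: "t \<cdot> x + (t * t) \<cdot> y = 0" for t
  proof -
    have "(\<lambda>u. M u + t \<cdot> N u) \<in> L" by (rule comb[OF M N])
    from cube[OF this u] have
      "M (M (M u)) + (t \<cdot> x + (t * t) \<cdot> y) + (t * t * t) \<cdot> N (N (N u)) = 0"
      by (simp add: x_def y_def add[OF M] add[OF N] scl[OF M] scl[OF N] scale_right_distrib ac_simps)
    then show ?thesis using cube[OF M u] cube[OF N u] by simp
  qed
  obtain c :: 'a where c: "c \<noteq> 0" "c \<noteq> 1" using exists_scalar by blast
  have 1: "x = - y" using *[of 1] by (simp add: eq_neg_iff_add_eq_0)
  have "(c * c - c) \<cdot> y = 0"
    using *[of c] by (simp add: 1 scale_left_diff_distrib)
  then have "y = 0" using c by auto
  then show ?thesis using 1 x_def by simp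
qed

lemma rank_one_subspace:
  assumes R: "subspace R" and V: "subspace V"
    and rank1: "\<forall>M\<in>L. \<forall>u\<in>V. \<forall>v\<in>V. M u \<notin> R \<longrightarrow> M v \<in> span (insert (M u) R)"
  shows "(\<exists>w. \<forall>M\<in>L. \<forall>u\<in>V. M u \<in> span (insert w R)) \<or>
    (\<exists>x\<in>V. \<forall>u\<in>V. \<exists>c. \<forall>M\<in>L. M (u - c \<cdot> x) \<in> R)"
proof (rule rank_one_family[OF R _ _ _ V])
  show "M (u + v) = M u + M v" if "M \<in> L" for M u v using that by (rule add)
  show "M (c \<cdot> u) = c \<cdot> M u" if "M \<in> L" for M c u using that by (rule scl)
  show "(\<lambda>u. M u + N u) \<in> L" if "M \<in> L" "N \<in> L" for M N using that by (rule sum2)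
  show "M v \<in> span (insert (M u) R)" if "M \<in> L" "u \<in> V" "v \<in> V" "M u \<notin> R" for M u v
    using that rank1 by blast
qed

lemma rank_one_family_zero:
  assumes V: "subspace V"
    and rank1: "\<forall>M\<in>L. \<forall>u\<in>V. \<forall>v\<in>V. M u \<noteq> 0 \<longrightarrow> M v \<in> span {M u}"
  shows "(\<exists>w. \<forall>M\<in>L. \<forall>u\<in>V. M u \<in> span {w}) \<or>
    (\<exists>x\<in>V. \<forall>u\<in>V. \<exists>c. \<forall>M\<in>L. M (u - c \<cdot> x) = 0)"
proof -
  have *: "span (insert a {0}) = span {a}" for a
    by (metis insert_commute span_insert_0)
  from rank_one_subspace[of "{0}" V] rank1 V show ?thesis
    by (simp add: *)
qed

abbreviation common_kernel :: bool where
  "common_kernel \<equiv> \<exists>v\<in>U. v \<noteq> 0 \<and> (\<forall>M\<in>L. M v = 0)"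

text \<open>If there is a common image line, its generator is an eigenvector of every member, hence
  killed. If there is a common kernel modulo \<open>x\<close>, any \<open>u\<close> outside
  \<open>span {x}\<close> can be corrected by a multiple of \<open>x\<close>; if no such
  \<open>u\<close> exists, \<open>x\<close> is an eigenvector.\<close>

lemma rank_le_one:
  assumes rank1: "\<forall>M\<in>L. \<forall>u\<in>U. \<forall>v\<in>U. M u \<noteq> 0 \<longrightarrow> M v \<in> span {M u}"
    and nontriv: "\<exists>u\<in>U. u \<noteq> 0"
  shows common_kernel
proof -
  from rank_one_family_zero[OF subspace_U rank1]
  consider w where "\<forall>M\<in>L. \<forall>u\<in>U. M u \<in> span {w}"
    | x where "x \<in> U" "\<forall>u\<in>U. \<exists>c. \<forall>M\<in>L. M (u - c \<cdot> x) = 0"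
    by blast
  then show ?thesis
  proof cases
    case w: 1
    show ?thesis
    proof (cases "\<forall>M\<in>L. \<forall>u\<in>U. M u = 0")
      case True
      then show ?thesis using nontriv by blast
    next
      case False
      then obtain M0 u0 where 0: "M0 \<in> L" "u0 \<in> U" "M0 u0 \<noteq> 0" by blast
      then obtain c where c: "M0 u0 = c \<cdot> w" using w by (auto simp: span_singleton)
      with 0 have "c \<noteq> 0" by auto
      then have "w = inverse c \<cdot> M0 u0" using c by simp
      then have "w \<in> U" using U_closed(3)[OF into[OF 0(1,2)]] by simp
      moreover have "w \<noteq> 0" using c 0(3) by auto
      ultimately show ?thesis using w eigen_span by blast
    qed
  next
    case x: 2
    show ?thesis
    proof (cases "U \<subseteq> span {x}")
      case True
      then have "M x = 0" if "M \<in> L" for M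
        using eigen_span[OF that x(1)] into[OF that x(1)] by auto
      moreover have "x \<noteq> 0" using True nontriv by (metis in_mono singletonD span_insert_0 span_empty)
      ultimately show ?thesis using x(1) by blast
    next
      case False
      then obtain u where u: "u \<in> U" "u \<notin> span {x}" by blast
      then obtain c where c: "\<forall>M\<in>L. M (u - c \<cdot> x) = 0" using x(2) by blast
      have "u - c \<cdot> x \<noteq> 0" using u(2) by (auto simp: span_singleton)
      moreover have "u - c \<cdot> x \<in> U" using u(1) x(1) by (intro U_closed)
      ultimately show ?thesis using c by blast
    qed
  qed
qed

text \<open>If some member \<open>M\<close> is nonzero on the plane, it maps the plane onto the line
  of some \<open>s\<close>, and the polarized cube makes \<open>s\<close> an eigenvector of every
  other member.\<close>

lemma common_image_plane:
  assumes p: "p \<in> U" "p \<noteq> 0" and q: "q \<in> U"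
    and im: "\<And>M u. M \<in> L \<Longrightarrow> u \<in> U \<Longrightarrow> M u \<in> span {p, q}"
  shows common_kernel
proof -
  let ?R = "span {p, q}"
  have RU: "?R \<subseteq> U" using p q subspace_U by (intro span_minimal) auto
  show ?thesis
  proof (cases "\<forall>M\<in>L. \<forall>r\<in>?R. M r = 0")
    case True
    then show ?thesis using p by (auto intro: span_base)
  next
    case False
    then obtain M r where M: "M \<in> L" and r: "r \<in> ?R" "M r \<noteq> 0" by blast
    define s where "s = M r"
    have s: "s \<in> ?R" "s \<noteq> 0" using im M r RU s_def by auto
    have rU: "r \<in> U" and sU: "s \<in> U" using r s RU by auto
    have rs: "r \<notin> span {s}"
    proof
      assume "r \<in> span {s}"
      then obtain c where c: "r = c \<cdot> s" by (auto simp: span_singleton)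
      then have "c \<noteq> 0" using r M by auto
      then have "s = inverse c \<cdot> r" using c by simp
      then show False using eigen[OF M rU, of "inverse c"] s s_def by simp
    qed
    have R: "?R \<subseteq> span {r, s}"
    proof -
      have *: "p \<in> span {r, s} \<and> q \<in> span {r, s}"
      proof (cases "s \<in> span {p}")
        case True
        then have p': "p \<in> span {s}" using in_span_insert[of s p "{}"] s(2) by auto
        then have "?R \<subseteq> span {s, q}"
          by (intro span_minimal) (auto intro: span_base set_mp[OF span_mono[of "{s}" "{s,q}"]])
        then have "r \<in> span (insert q {s})" using r(1) by (auto simp: insert_commute)
        from in_span_insert[OF this rs] p' show ?thesis
          by (auto intro: set_mp[OF span_mono[of "{s}" "{r, s}"]])
      next
        case False
        then have q': "q \<in> span {s, p}" using in_span_insert[of s q "{p}"] s(1) 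
          by (auto simp: insert_commute)
        then have "?R \<subseteq> span {s, p}"
          by (intro span_minimal) (auto intro: span_base)
        then have "r \<in> span (insert p {s})" using r(1) by (auto simp: insert_commute)
        from in_span_insert[OF this rs] have p': "p \<in> span {r, s}" by simp
        then have "span {s, p} \<subseteq> span {r, s}" by (intro span_minimal) (auto intro: span_base)
        then show ?thesis using p' q' by blast
      qed
      then show ?thesis by (intro span_minimal) auto
    qed
    have rs_repr: "\<exists>x y. v = x \<cdot> r + y \<cdot> s" if "v \<in> ?R" for v
    proof -
      have "v \<in> span (insert r {s})" using that R by auto
      then obtain x where "v - x \<cdot> r \<in> span {s}" by (auto simp: span_breakdown_eq)
      then obtain y where "v - x \<cdot> r = y \<cdot> s" by (auto simp: span_singleton)
      then show ?thesis by (intro exI[of _ x] exI[of _ y]) (simp add: algebra_simps)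
    qed
    have Ms: "M s = 0"
    proof -
      obtain x y where xy: "M s = x \<cdot> r + y \<cdot> s" using rs_repr im[OF M sU] by blast
      have c: "M (M s) = 0" using cube[OF M rU] s_def by simp
      have "M (M s) = M (x \<cdot> r + y \<cdot> s)" using xy by (rule arg_cong)
      also have "\<dots> = x \<cdot> s + y \<cdot> M s" by (simp only: add[OF M] scl[OF M] s_def)
      finally have "x \<cdot> s + y \<cdot> M s = 0" using c by simp
      then have "M (x \<cdot> s + y \<cdot> M s) = M 0" by (rule arg_cong)
      then have "x \<cdot> M s = 0" using c by (simp only: add[OF M] scl[OF M] zero[OF M] scale_zero_right add_0_right)
      then have "x = 0 \<or> M s = 0" by simp
      then show ?thesis using xy eigen[OF M sU, of y] by auto
    qed
    have "N s = 0" if N: "N \<in> L" for N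
    proof -
      obtain x y where xy: "N s = x \<cdot> r + y \<cdot> s" using rs_repr im[OF N sU] by blast
      have MM: "M (M v) = 0" if "v \<in> ?R" for v
      proof -
        obtain x y where "v = x \<cdot> r + y \<cdot> s" using rs_repr[OF \<open>v \<in> ?R\<close>] by blast
        then show ?thesis by (simp add: add[OF M] scl[OF M] Ms s_def[symmetric] M)
      qed
      \<comment> \<open>The outer terms vanish because \<open>M\<close> squares to zero on the
        plane. So \<open>M (N s) = 0\<close>, which removes the \<open>r\<close>-component of
        \<open>N s\<close>.\<close>
      have "M (M (N r)) + M (N (M r)) + N (M (M r)) = 0" by (rule cube_polar[OF M N rU])
      then have "M (N s) = 0" using MM im[OF N rU] Ms N by (simp add: s_def[symmetric])
      then have "x \<cdot> s = 0" by (simp add: xy add[OF M] scl[OF M] Ms s_def[symmetric])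
      then show ?thesis using xy eigen[OF N sU, of y] s by simp
    qed
    then show ?thesis using s sU by blast
  qed
qed

end


section \<open>Families with a member of rank two\<close>

locale rank_two_member = nilpotent_family +
  fixes N :: "'b \<Rightarrow> 'b" and a b :: 'b
  assumes N: "N \<in> L" and a: "a \<in> U" and b: "b \<in> U"
    and Na: "N a \<noteq> 0" and NNa: "N (N a) = 0" and Nb: "N b \<notin> span {N a}"
begin

definition R :: "'b set" where "R = span {N a, N b}"

lemma subspace_R: "subspace R"
  by (simp add: R_def)

lemmas R_closed = subspace_add[OF subspace_R] subspace_diff[OF subspace_R]
  subspace_scale[OF subspace_R] subspace_0[OF subspace_R]

lemma Na_in_R: "N a \<in> R" and Nb_in_R: "N b \<in> R"
  by (auto simp: R_def intro: span_base)

lemma scale_in_R: "c \<cdot> v \<in> R \<longleftrightarrow> c = 0 \<or> v \<in> R"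
proof -
  have "v \<in> R" if "c \<cdot> v \<in> R" "c \<noteq> 0"
    using subspace_scale[OF subspace_R that(1), of "inverse c"] that(2) by simp
  then show ?thesis by (auto intro: R_closed)
qed

lemma image_N: "u \<in> U \<Longrightarrow> N u \<in> R"
  unfolding R_def by (rule dep3_cases[OF rank[OF N a b] Na Nb])

lemma in_R_iff: "v \<in> R \<longleftrightarrow> (\<exists>x y. v = x \<cdot> N a + y \<cdot> N b)"
proof
  assume "v \<in> R"
  then have "v \<in> span (insert (N a) {N b})" by (simp add: R_def)
  then obtain x where "v - x \<cdot> N a \<in> span {N b}" by (auto simp: span_breakdown_eq)
  then obtain y where "v - x \<cdot> N a = y \<cdot> N b" by (auto simp: span_singleton)
  then show "\<exists>x y. v = x \<cdot> N a + y \<cdot> N b"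
    by (intro exI[of _ x] exI[of _ y]) (simp add: algebra_simps)
qed (auto intro: R_closed Na_in_R Nb_in_R)

text \<open>The rank of \<open>N + t M\<close> is at most two for all \<open>t\<close>, and \<open>N a + t M a\<close>, \<open>N b + t M b\<close> stay
  independent near \<open>t = 0\<close>; a direction that lies in the image for all \<open>t \<noteq> 0\<close>
  survives the limit.\<close>

lemma perturb:
  assumes M: "M \<in> L"
    and v: "\<And>t. t \<noteq> 0 \<Longrightarrow> \<exists>u\<in>U. \<exists>c. c \<noteq> 0 \<and> N u + t \<cdot> M u = c \<cdot> v"
  shows "v \<in> R"
proof -
  have "dep3 (N a + t \<cdot> M a) (N b + t \<cdot> M b) (v + t \<cdot> 0)" if "t \<noteq> 0" for t
  proof -
    obtain u c where u: "u \<in> U" "c \<noteq> 0" "N u + t \<cdot> M u = c \<cdot> v" using v \<open>t \<noteq> 0\<close> by blast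
    have "dep3 (N a + t \<cdot> M a) (N b + t \<cdot> M b) (N u + t \<cdot> M u)"
      using rank[OF comb[OF N M] a b u(1)] .
    then show ?thesis using dep3_cancel u by simp
  qed
  then have "dep3 (N a) (N b) v" by (rule dep3_limit)
  then show ?thesis unfolding R_def by (rule dep3_cases[OF _ Na Nb])
qed

text \<open>First order: \<open>(N + t M) z = t M z\<close>, so the direction of \<open>M z\<close>
  lies in the image of every \<open>N + t M\<close> with \<open>t \<noteq> 0\<close>.\<close>

lemma kernel_image:
  assumes M: "M \<in> L" and z: "z \<in> U" "N z = 0"
  shows "M z \<in> R"
proof (rule perturb[OF M])
  fix t :: 'a assume "t \<noteq> 0"
  then show "\<exists>u\<in>U. \<exists>c. c \<noteq> 0 \<and> N u + t \<cdot> M u = c \<cdot> M z"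
    using z by (intro bexI[of _ z] exI[of _ t]) auto
qed

text \<open>The correction \<open>z - t y\<close> cancels the first order term:
  \<open>(N + t M) (z - t y) = - t^2 M y\<close>.\<close>

lemma second_order:
  assumes M: "M \<in> L" and z: "z \<in> U" "N z = 0" and y: "y \<in> U" "M z = N y"
  shows "M y \<in> R"
proof (rule perturb[OF M])
  fix t :: 'a assume t: "t \<noteq> 0"
  have "N (z - t \<cdot> y) + t \<cdot> M (z - t \<cdot> y) = (- t * t) \<cdot> M y"
    by (simp add: diff[OF N] diff[OF M] scl[OF N] scl[OF M] z y scale_right_diff_distrib)
  moreover have "z - t \<cdot> y \<in> U" using z y by (intro U_closed)
  ultimately show "\<exists>u\<in>U. \<exists>c. c \<noteq> 0 \<and> N u + t \<cdot> M u = c \<cdot> M y"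
    using t by (intro bexI[of _ "z - t \<cdot> y"] exI[of _ "- t * t"]) auto
qed

lemma decompose:
  assumes "u \<in> U"
  obtains z x y where "z \<in> U" "N z = 0" "u = z + x \<cdot> a + y \<cdot> b"
proof -
  obtain x y where xy: "N u = x \<cdot> N a + y \<cdot> N b"
    using image_N[OF assms] in_R_iff by blast
  show ?thesis
  proof
    show "u - x \<cdot> a - y \<cdot> b \<in> U" using assms a b by (intro U_closed)
    show "N (u - x \<cdot> a - y \<cdot> b) = 0" by (simp add: diff[OF N] scl[OF N] xy)
    show "u = u - x \<cdot> a - y \<cdot> b + x \<cdot> a + y \<cdot> b" by simp
  qed
qed

text \<open>Every member maps the kernel of \<open>N\<close> into \<open>R\<close>, so modulo
  \<open>R\<close> it is determined by its values at \<open>a\<close> and \<open>b\<close>.\<close>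

lemma in_R_of_generators:
  assumes M: "M \<in> L" and "M a \<in> R" "M b \<in> R" "u \<in> U"
  shows "M u \<in> R"
proof -
  obtain z x y where z: "z \<in> U" "N z = 0" "u = z + x \<cdot> a + y \<cdot> b" using decompose[OF \<open>u \<in> U\<close>] .
  have "M u = M z + x \<cdot> M a + y \<cdot> M b" by (simp add: z add[OF M] scl[OF M])
  also have "\<dots> \<in> R"
    by (intro R_closed(1,3) kernel_image[OF M z(1,2)] assms)
  finally show ?thesis .
qed

lemma Na_U: "N a \<in> U"
  by (rule into[OF N a])

text \<open>Each \<open>M' (N a)\<close> lies in \<open>R\<close>, while \<open>M p\<close> and
  \<open>M q\<close> are independent modulo \<open>R\<close>; so a dependence among the three forces
  \<open>M' (N a) = 0\<close>. It is obtained as a limit from \<open>M + t M'\<close>, whose value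
  at \<open>N a\<close> is \<open>t M' (N a)\<close> once \<open>M (N a) = 0\<close> is
  known.\<close>

lemma kernel_if_rank_two_mod_R:
  assumes M: "M \<in> L" and p: "p \<in> U" "M p \<notin> R" and q: "q \<in> U" "M q \<notin> span (insert (M p) R)"
  shows common_kernel
proof -
  have *: "x = 0" if d: "dep3 x (M p) (M q)" and x: "x \<in> R" for x
  proof (rule ccontr)
    assume x0: "x \<noteq> 0"
    have "span {x} \<subseteq> R" by (rule span_minimal[OF _ subspace_R]) (use x in simp)
    then have "M p \<notin> span {x}" using p(2) by blast
    then have "M q \<in> span {x, M p}" by (rule dep3_cases[OF d x0])
    moreover have "span {x, M p} \<subseteq> span (insert (M p) R)" by (rule span_mono) (use x in simp)
    ultimately show False using q(2) by blast
  qed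
  have Me: "M (N a) = 0"
    by (rule *[OF rank[OF M Na_U p(1) q(1)] kernel_image[OF M Na_U NNa]])
  have "M' (N a) = 0" if M': "M' \<in> L" for M'
  proof (rule *[OF dep3_limit kernel_image[OF M' Na_U NNa]])
    fix t :: 'a assume t: "t \<noteq> 0"
    have "dep3 (t \<cdot> M' (N a)) (M p + t \<cdot> M' p) (M q + t \<cdot> M' q)"
      using rank[OF comb[OF M M'] Na_U p(1) q(1), of t] Me by simp
    then have "dep3 (M p + t \<cdot> M' p) (M q + t \<cdot> M' q) (t \<cdot> M' (N a))" by (rule dep3_rotate)
    then have "dep3 (M p + t \<cdot> M' p) (M q + t \<cdot> M' q) (M' (N a))" using t by (rule dep3_cancel)
    then have "dep3 (M' (N a)) (M p + t \<cdot> M' p) (M q + t \<cdot> M' q)"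
      by (rule dep3_rotate[OF dep3_rotate])
    then show "dep3 (M' (N a) + t \<cdot> 0) (M p + t \<cdot> M' p) (M q + t \<cdot> M' q)" by simp
  qed
  then show ?thesis using Na_U Na by blast
qed

text \<open>With \<open>M (N a) = N (x a + y b)\<close>, \<open>second_order\<close> applied to \<open>M\<close> and to \<open>M + M2\<close> forces \<open>y = 0\<close>, so
  \<open>N a\<close> is an eigenvector of every member.\<close>

lemma kernel_if_separated:
  assumes M2: "M2 \<in> L" and "M2 a \<in> R" "M2 b \<notin> R"
  shows common_kernel
proof -
  have y0: "y = 0" if "M2 (x \<cdot> a + y \<cdot> b) \<in> R" for x y
  proof -
    have "M2 (x \<cdot> a + y \<cdot> b) = x \<cdot> M2 a + y \<cdot> M2 b" by (simp add: add[OF M2] scl[OF M2])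
    then have "y \<cdot> M2 b \<in> R"
      using that R_closed(2)[of "M2 (x \<cdot> a + y \<cdot> b)" "x \<cdot> M2 a"] assms(2)
      by (simp add: scale_in_R)
    then show ?thesis using assms(3) by (simp add: scale_in_R)
  qed
  have *: "\<exists>x y. M (N a) = x \<cdot> N a + y \<cdot> N b \<and> M (x \<cdot> a + y \<cdot> b) \<in> R" if M: "M \<in> L" for M
  proof -
    obtain x y where xy: "M (N a) = x \<cdot> N a + y \<cdot> N b"
      using kernel_image[OF M Na_U NNa] in_R_iff by blast
    moreover have "M (x \<cdot> a + y \<cdot> b) \<in> R"
      by (rule second_order[OF M Na_U NNa]) (simp_all add: xy U_closed a b add[OF N] scl[OF N])
    ultimately show ?thesis by blast
  qed
  obtain x2 y2 where "M2 (N a) = x2 \<cdot> N a + y2 \<cdot> N b" "M2 (x2 \<cdot> a + y2 \<cdot> b) \<in> R"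
    using *[OF M2] by blast
  then have M2e: "M2 (N a) = 0" using y0 eigen[OF M2 Na_U, of x2] by simp
  have "M (N a) = 0" if M: "M \<in> L" for M
  proof -
    obtain x y where xy: "M (N a) = x \<cdot> N a + y \<cdot> N b" "M (x \<cdot> a + y \<cdot> b) \<in> R"
      using *[OF M] by blast
    have "M (x \<cdot> a + y \<cdot> b) + M2 (x \<cdot> a + y \<cdot> b) \<in> R"
      by (rule second_order[OF sum2[OF M M2] Na_U NNa])
        (simp_all add: xy M2e U_closed a b add[OF N] scl[OF N])
    from R_closed(2)[OF this xy(2)] have "M2 (x \<cdot> a + y \<cdot> b) \<in> R" by simp
    then have "y = 0" by (rule y0)
    then show ?thesis using xy eigen[OF M Na_U, of x] by simp
  qed
  then show ?thesis using Na_U Na by blast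
qed

lemma kernel_if_image_in_R:
  assumes "\<And>M u. M \<in> L \<Longrightarrow> u \<in> U \<Longrightarrow> M u \<in> R"
  shows common_kernel
proof (rule common_image_plane[OF Na_U Na into[OF N b]])
  show "M u \<in> span {N a, N b}" if "M \<in> L" "u \<in> U" for M u
    using assms[OF that] by (simp add: R_def)
qed

text \<open>\<open>K = U\<close> is allowed. The vector \<open>w\<close> is required to lie in
  \<open>U\<close>, so that members can be applied to it and eigenvector arguments are
  available.\<close>

definition compression :: "'b set \<Rightarrow> 'b \<Rightarrow> 'b \<Rightarrow> bool" where
  "compression K x w \<longleftrightarrow> subspace K \<and> K \<subseteq> U \<and> x \<in> U \<and> w \<in> U \<and> w \<noteq> 0 \<and>
    (\<forall>u\<in>U. \<exists>k\<in>K. \<exists>c. u = k + c \<cdot> x) \<and> (\<forall>M\<in>L. \<forall>k\<in>K. M k \<in> span {w})"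

text \<open>The vectors that all members map into \<open>R\<close> form a subspace \<open>K\<close>
  of codimension at most one. A member with \<open>M x\<close> outside \<open>R\<close> spends one
  dimension of its rank there and has rank at most one on \<open>K\<close>; perturbation extends
  this to all members, and the rank one alternative applies on \<open>K\<close>.\<close>

lemma hyperplane:
  assumes x: "x \<in> U" and hyp: "\<forall>u\<in>U. \<exists>c. \<forall>M\<in>L. M (u - c \<cdot> x) \<in> R"
  shows "common_kernel \<or> (\<exists>K x w. compression K x w)"
proof (cases "\<forall>M\<in>L. M x \<in> R")
  case True
  have "M u \<in> R" if M: "M \<in> L" and u: "u \<in> U" for M u
  proof -
    obtain c where c: "\<forall>M\<in>L. M (u - c \<cdot> x) \<in> R" using bspec[OF hyp u] by (elim exE)
    have "M (u - c \<cdot> x) + c \<cdot> M x \<in> R"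
      by (intro R_closed(1,3) bspec[OF c M] bspec[OF True M])
    then show ?thesis by (simp add: diff[OF M] scl[OF M])
  qed
  then show ?thesis by (intro disjI1 kernel_if_image_in_R)
next
  case False
  then obtain M1 where M1: "M1 \<in> L" "M1 x \<notin> R" by blast
  define K where "K = {u\<in>U. \<forall>M\<in>L. M u \<in> R}"
  have K: "subspace K"
    unfolding K_def
    by (rule subspaceI) (simp_all add: add scl R_closed U_closed)
  have KR: "M k \<in> R" if "M \<in> L" "k \<in> K" for M k
    using that by (auto simp: K_def)
  have KU: "K \<subseteq> U" by (auto simp: K_def)
  have NaK: "N a \<in> K" using Na_U kernel_image[OF _ Na_U NNa] by (auto simp: K_def)
  have dec: "\<exists>k\<in>K. \<exists>c. u = k + c \<cdot> x" if u: "u \<in> U" for u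
  proof -
    obtain c where "\<forall>M\<in>L. M (u - c \<cdot> x) \<in> R" using bspec[OF hyp u] by (elim exE)
    moreover have "u - c \<cdot> x \<in> U" using u x by (intro U_closed)
    ultimately have "u - c \<cdot> x \<in> K" by (simp add: K_def)
    then show ?thesis by (intro bexI[of _ "u - c \<cdot> x"] exI[of _ c]) auto
  qed
  have rk: "M u = 0 \<or> M v \<in> span {M u}"
    if M: "M \<in> L" and uv: "u \<in> K" "v \<in> K" and Mx: "M x \<notin> R" for M u v
  proof (rule ccontr)
    assume "\<not> ?thesis"
    then have "M x \<in> span {M u, M v}"
      using dep3_cases[OF rank[OF M subsetD[OF KU uv(1)] subsetD[OF KU uv(2)] x]] by blast
    moreover have "span {M u, M v} \<subseteq> R"
      using KR[OF M] uv by (intro span_minimal subspace_R) auto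
    ultimately show False using Mx by blast
  qed
  have rank1: "\<forall>M\<in>L. \<forall>u\<in>K. \<forall>v\<in>K. M u \<noteq> 0 \<longrightarrow> M v \<in> span {M u}"
  proof (intro ballI impI)
    fix M u v assume M: "M \<in> L" and uv: "u \<in> K" "v \<in> K" and Mu: "M u \<noteq> 0"
    show "M v \<in> span {M u}"
    proof (cases "M x \<in> R")
      case False
      then show ?thesis using rk[OF M uv] Mu by blast
    next
      case True
      \<comment> \<open>The vector \<open>M1 x\<close> completes the dependent pair to a triple, so
        that the limit of \<open>dep3\<close> can be used. As \<open>M1 x\<close> is outside
        \<open>R\<close>, it is not in the span of \<open>M u\<close> and \<open>M v\<close>, and
        the pair itself must be dependent.\<close>
      have "dep3 (M u + t \<cdot> M1 u) (M v + t \<cdot> M1 v) (M1 x + t \<cdot> 0)" if t: "t \<noteq> 0" for t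
      proof (rule dep3_if_dependent2)
        have "M x + t \<cdot> M1 x \<notin> R"
          using R_closed(2)[of "M x + t \<cdot> M1 x" "M x"] True M1(2) t by (auto simp: scale_in_R)
        then show "M u + t \<cdot> M1 u = 0 \<or> M v + t \<cdot> M1 v \<in> span {M u + t \<cdot> M1 u}"
          using rk[OF comb[OF M M1(1)] uv] by blast
      qed
      then have d: "dep3 (M u) (M v) (M1 x)" by (rule dep3_limit)
      have "span {M u, M v} \<subseteq> R"
        using KR[OF M] uv by (intro span_minimal subspace_R) auto
      then show ?thesis using dep3_cases[OF d Mu] M1(2) by blast
    qed
  qed
  from rank_one_family_zero[OF K rank1] show ?thesis
  proof
    assume "\<exists>w. \<forall>M\<in>L. \<forall>u\<in>K. M u \<in> span {w}"
    then obtain w where w: "\<forall>M\<in>L. \<forall>u\<in>K. M u \<in> span {w}" by blast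
    show ?thesis
    proof (cases "\<forall>M\<in>L. M (N a) = 0")
      case True
      then show ?thesis using Na_U Na by blast
    next
      case False
      then obtain M0 where M0: "M0 \<in> L" "M0 (N a) \<noteq> 0" by blast
      \<comment> \<open>The vector \<open>w\<close> is not known to lie in \<open>U\<close> or to be
        nonzero; a nonzero value at \<open>N a \<in> K\<close> is both and generates the same
        line.\<close>
      define w' where "w' = M0 (N a)"
      have w': "w' \<in> U" "w' \<noteq> 0" using M0 Na_U into w'_def by auto
      have "w' \<in> span (insert w {})" using w M0 NaK w'_def by blast
      then have "w \<in> span {w'}" using in_span_insert[of w' w "{}"] w'(2) by simp
      then have "span {w} \<subseteq> span {w'}" by (intro span_minimal) auto
      then have "compression K x w'"
        using K KU x w' dec w unfolding compression_def by blast
      then show ?thesis by blast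
    qed
  next
    assume "\<exists>x\<in>K. \<forall>u\<in>K. \<exists>c. \<forall>M\<in>L. M (u - c \<cdot> x) = 0"
    then obtain x1 where x1: "x1 \<in> K" "\<forall>u\<in>K. \<exists>c. \<forall>M\<in>L. M (u - c \<cdot> x1) = 0" by blast
    show ?thesis
    proof (cases "K \<subseteq> span {x1}")
      case False
      then obtain u where u: "u \<in> K" "u \<notin> span {x1}" by blast
      from bspec[OF x1(2) u(1)] obtain c where c: "\<forall>M\<in>L. M (u - c \<cdot> x1) = 0" by (elim exE)
      have "u - c \<cdot> x1 \<noteq> 0" using u(2) by (auto simp: span_singleton)
      moreover have "u - c \<cdot> x1 \<in> U" using u(1) x1(1) KU by (intro U_closed) auto
      ultimately show ?thesis using c by blast
    next
      case True
      then have "N a \<in> span (insert x1 {})" using NaK by blast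
      then have "x1 \<in> span {N a}" using in_span_insert[of "N a" x1 "{}"] Na by simp
      then have "span {x1} \<subseteq> span {N a}" by (intro span_minimal) auto
      \<comment> \<open>Here \<open>K\<close> is the line of \<open>N a\<close>, on which
        \<open>N\<close> vanishes. With codimension at most one, \<open>N\<close> would have rank at
        most one, against \<open>Nb\<close>.\<close>
      have K0: "N k = 0" if k: "k \<in> K" for k
      proof -
        have "k \<in> span {N a}" using k True \<open>span {x1} \<subseteq> span {N a}\<close> by blast
        then obtain r where "k = r \<cdot> N a" by (auto simp: span_singleton)
        then show ?thesis by (simp add: NNa scl[OF N])
      qed
      obtain k c where "a = k + c \<cdot> x" "k \<in> K" using dec[OF a] by blast
      then have ac: "N a = c \<cdot> N x" by (simp add: K0 add[OF N] scl[OF N])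
      then have "c \<noteq> 0" using Na by auto
      obtain k' c' where "b = k' + c' \<cdot> x" "k' \<in> K" using dec[OF b] by blast
      then have "N b = c' \<cdot> N x" by (simp add: K0 add[OF N] scl[OF N])
      also have "\<dots> = (c' / c) \<cdot> N a" using ac \<open>c \<noteq> 0\<close> by simp
      finally have "N b \<in> span {N a}" by (auto simp: span_singleton)
      then show ?thesis using Nb by blast
    qed
  qed
qed

text \<open>Apart from \<open>kernel_if_rank_two_mod_R\<close>, all members have rank at most one
  modulo \<open>R\<close>. A common kernel modulo \<open>R\<close> is the situation of
  \<open>hyperplane\<close>. A common image line is reduced to it: unless some member separates
  \<open>b\<close> from \<open>a\<close>, all members map one and the same
  \<open>b - \<kappa> a\<close> into \<open>R\<close>.\<close>

lemma kernel_or_compression: "common_kernel \<or> (\<exists>K x w. compression K x w)"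
proof (cases "\<forall>M\<in>L. \<forall>u\<in>U. \<forall>v\<in>U. M u \<notin> R \<longrightarrow> M v \<in> span (insert (M u) R)")
  case False
  then obtain M u v where "M \<in> L" "u \<in> U" "M u \<notin> R" "v \<in> U" "M v \<notin> span (insert (M u) R)"
    by blast
  then show ?thesis by (intro disjI1 kernel_if_rank_two_mod_R)
next
  case rank1: True
  from rank_one_subspace[OF subspace_R subspace_U rank1] show ?thesis
  proof
    assume "\<exists>x\<in>U. \<forall>u\<in>U. \<exists>c. \<forall>M\<in>L. M (u - c \<cdot> x) \<in> R"
    then show ?thesis by (elim bexE) (rule hyperplane)
  next
    assume "\<exists>w. \<forall>M\<in>L. \<forall>u\<in>U. M u \<in> span (insert w R)"
    then obtain d where d: "\<forall>M\<in>L. \<forall>u\<in>U. M u \<in> span (insert d R)" by blast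
    have spR: "span R = R" using subspace_R by (simp add: span_eq_iff)
    show ?thesis
    proof (cases "\<exists>M\<in>L. M a \<in> R \<and> M b \<notin> R")
      case True
      then obtain M where "M \<in> L" "M a \<in> R" "M b \<notin> R" by blast
      then show ?thesis by (intro disjI1 kernel_if_separated)
    next
      case sep: False
      show ?thesis
      proof (cases "\<forall>M\<in>L. M a \<in> R")
        case True
        then have "M u \<in> R" if "M \<in> L" "u \<in> U" for M u
          using in_R_of_generators[OF that(1)] sep that by blast
        then show ?thesis by (intro disjI1 kernel_if_image_in_R)
      next
        case False
        then obtain M3 where M3: "M3 \<in> L" "M3 a \<notin> R" by blast
        \<comment> \<open>\<open>\<kappa>\<close> is the ratio of \<open>M3 b\<close> to
          \<open>M3 a\<close> modulo \<open>R\<close>. It serves every \<open>M\<close>: if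
          \<open>M a\<close> is \<open>c M3 a\<close> modulo \<open>R\<close>, then
          \<open>M - c M3\<close> sends \<open>a\<close> into \<open>R\<close>, hence
          \<open>b\<close> as well.\<close>
        obtain \<kappa> where \<kappa>: "M3 b - \<kappa> \<cdot> M3 a \<in> R"
          using rank1[rule_format, OF M3(1) a b M3(2)] by (auto simp: span_breakdown_eq spR)
        have d3: "span (insert d R) \<subseteq> span (insert (M3 a) R)"
        proof -
          have "d \<in> span (insert (M3 a) R)"
            using in_span_insert[of "M3 a" d R] d M3 a spR by auto
          then show ?thesis by (intro span_minimal) (auto intro: span_base)
        qed
        have *: "M (b - \<kappa> \<cdot> a) \<in> R" if M: "M \<in> L" for M
        proof -
          obtain c where c: "M a - c \<cdot> M3 a \<in> R"
            using subsetD[OF d3 d[rule_format, OF M a]] by (auto simp: span_breakdown_eq spR)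
          have "(\<lambda>u. M u + (- c) \<cdot> M3 u) \<in> L" by (rule comb[OF M M3(1)])
          then have 1: "M b - c \<cdot> M3 b \<in> R" using sep c by auto
          have "M (b - \<kappa> \<cdot> a) = (M b - c \<cdot> M3 b) - \<kappa> \<cdot> (M a - c \<cdot> M3 a)
            + c \<cdot> (M3 b - \<kappa> \<cdot> M3 a)"
            by (simp add: diff[OF M] scl[OF M] scale_right_diff_distrib mult.commute)
          also have "\<dots> \<in> R"
            by (intro R_closed(1-3) c 1 \<kappa>)
          finally show ?thesis .
        qed
        have "\<forall>u\<in>U. \<exists>c. \<forall>M\<in>L. M (u - c \<cdot> a) \<in> R"
        proof
          fix u assume "u \<in> U"
          obtain z x y where z: "z \<in> U" "N z = 0" "u = z + x \<cdot> a + y \<cdot> b"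
            using decompose[OF \<open>u \<in> U\<close>] .
          have "M (u - (x + y * \<kappa>) \<cdot> a) \<in> R" if M: "M \<in> L" for M
          proof -
            have "u - (x + y * \<kappa>) \<cdot> a = z + y \<cdot> (b - \<kappa> \<cdot> a)"
              by (simp add: z scale_left_distrib scale_right_diff_distrib)
            then have "M (u - (x + y * \<kappa>) \<cdot> a) = M z + y \<cdot> M (b - \<kappa> \<cdot> a)"
              by (simp only: add[OF M] scl[OF M])
            also have "\<dots> \<in> R"
              by (intro R_closed(1,3) kernel_image[OF M z(1,2)] *[OF M])
            finally show ?thesis .
          qed
          then show "\<exists>c. \<forall>M\<in>L. M (u - c \<cdot> a) \<in> R" by (intro exI ballI)
        qed
        then show ?thesis by (rule hyperplane[OF a])
      qed
    qed
  qed
qed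

end

section \<open>Using the symmetry of the bilinear part\<close>

locale symmetric_family = nilpotent_family +
  fixes A0 :: "'b \<Rightarrow> 'b" and B :: "'b \<Rightarrow> 'b \<Rightarrow> 'b"
  assumes A0: "A0 \<in> L" and B: "x \<in> U \<Longrightarrow> B x \<in> L"
    and sym: "x \<in> U \<Longrightarrow> y \<in> U \<Longrightarrow> B x y = B y x"
    and repr: "M \<in> L \<Longrightarrow> \<exists>s. \<exists>x\<in>U. \<forall>u\<in>U. M u = s \<cdot> A0 u + B x u"
begin

text \<open>This fails without symmetry, as the span of
  \<open>((0,1,0),(0,0,1),(0,0,0))\<close> and \<open>((0,0,0),(1,0,0),(0,-1,0))\<close> shows.\<close>

lemma compression_kernel:
  assumes K: "subspace K" "K \<subseteq> U" and x: "x \<in> U" and w: "w \<in> U" "w \<noteq> 0"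
    and dec: "\<forall>u\<in>U. \<exists>k\<in>K. \<exists>c. u = k + c \<cdot> x"
    and im: "\<forall>M\<in>L. \<forall>k\<in>K. M k \<in> span {w}"
  shows common_kernel
proof (cases "w \<in> K")
  case True
  then have "M w = 0" if "M \<in> L" for M
    using eigen_span[OF that w(1)] im that by blast
  then show ?thesis using w by blast
next
  case False
  \<comment> \<open>Being outside \<open>K\<close>, the vector \<open>w\<close> can replace
    \<open>x\<close> as a complement.\<close>
  have decw: "\<exists>k\<in>K. \<exists>c. u = k + c \<cdot> w" if u: "u \<in> U" for u
  proof -
    obtain k c where k: "k \<in> K" "w = k + c \<cdot> x" using dec w by blast
    then have c: "c \<noteq> 0" using False by auto
    have xw: "x = inverse c \<cdot> (w - k)" using k c by simp
    obtain k' c' where k': "k' \<in> K" "u = k' + c' \<cdot> x" using dec u by blast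
    have "u = (k' - (c' * inverse c) \<cdot> k) + (c' * inverse c) \<cdot> w"
      by (simp add: k'(2) xw scale_right_diff_distrib)
    moreover have "k' - (c' * inverse c) \<cdot> k \<in> K"
      using k k' K by (auto intro: subspace_diff subspace_scale)
    ultimately show ?thesis by blast
  qed
  \<comment> \<open>By symmetry \<open>B u w = B w u\<close> is on the line of \<open>w\<close>, so
    \<open>w\<close> is an eigenvector of \<open>B u\<close>.\<close>
  have Bw: "B u w = 0" if "u \<in> K" for u
  proof -
    have u: "u \<in> U" using that K by blast
    have "B u w \<in> span {w}" using im B[OF w(1)] that sym[OF u w(1)] by simp
    then show ?thesis using eigen_span[OF B[OF u] w(1)] by blast
  qed
  \<comment> \<open>The map sends \<open>w\<close> to \<open>k + c w\<close> and \<open>k\<close> to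
    \<open>r w\<close>; vanishing of the cube at \<open>w\<close> forces \<open>c = 0\<close> and
    \<open>r k = 0\<close>.\<close>
  have Mw: "M w \<in> K \<and> M (M w) = 0" if M: "M \<in> L" for M
  proof -
    obtain k c where k: "k \<in> K" "M w = k + c \<cdot> w" using decw[OF into[OF M w(1)]] by blast
    obtain r where r: "M k = r \<cdot> w" using im M k by (auto simp: span_singleton)
    have "M (M w) = M (k + c \<cdot> w)" using k(2) by (rule arg_cong)
    also have "\<dots> = c \<cdot> k + (r + c * c) \<cdot> w"
      by (simp only: add[OF M] scl[OF M] r k(2)) (simp add: algebra_simps)
    finally have 2: "M (M w) = c \<cdot> k + (r + c * c) \<cdot> w" .
    have "M (M (M w)) = M (c \<cdot> k + (r + c * c) \<cdot> w)" using 2 by (rule arg_cong)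
    also have "\<dots> = (r + c * c) \<cdot> k + (c * r + (r + c * c) * c) \<cdot> w"
      by (simp only: add[OF M] scl[OF M] r k(2))
        (simp add: scale_right_distrib scale_left_distrib distrib_right ac_simps)
    finally have 3: "(r + c * c) \<cdot> k + (c * r + (r + c * c) * c) \<cdot> w = 0"
      using cube[OF M w(1)] by simp
    define s where "s = c * r + (r + c * c) * c"
    have s: "s = 0"
    proof (rule ccontr)
      assume "s \<noteq> 0"
      have "s \<cdot> w = - ((r + c * c) \<cdot> k)" using 3 s_def by (simp add: eq_neg_iff_add_eq_0 add.commute)
      then have "s \<cdot> w \<in> K" using K(1) k(1) by (auto intro: subspace_neg subspace_scale)
      then have "inverse s \<cdot> s \<cdot> w \<in> K" by (rule subspace_scale[OF K(1)])
      then show False using False \<open>s \<noteq> 0\<close> by simp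
    qed
    then have "r + c * c = 0 \<or> k = 0" using 3 s_def by simp
    then have "c = 0"
    proof
      assume "k = 0"
      then show ?thesis using k(2) eigen[OF M w(1), of c] w(2) by simp
    next
      assume "r + c * c = 0"
      then have "r = - (c * c)" "c * r = 0" using s s_def by (simp_all add: eq_neg_iff_add_eq_0)
      then show ?thesis by simp
    qed
    have "r \<cdot> k = 0" using 3 \<open>c = 0\<close> by simp
    then have "r = 0 \<or> k = 0" by simp
    then have "M k = 0" using r M by auto
    then show ?thesis using k \<open>c = 0\<close> by simp
  qed
  have anti: "M (M' w) = - M' (M w)" if M: "M \<in> L" and M': "M' \<in> L" for M M'
    using conjunct2[OF Mw[OF sum2[OF M M']]] conjunct2[OF Mw[OF M]] conjunct2[OF Mw[OF M']]
    by (simp add: add[OF M] add[OF M'] eq_neg_iff_add_eq_0 add.commute)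
  \<comment> \<open>Symmetry moves \<open>y\<close> into the second argument, where it splits as
    \<open>k + c w\<close>. Then \<open>B k (M w) = - M (B k w) = 0\<close> by anticommutation, and
    \<open>B w (M w) = B (M w) w = 0\<close> because \<open>M w \<in> K\<close>.\<close>
  have BM: "B y (M w) = 0" if y: "y \<in> U" and M: "M \<in> L" for y M
  proof -
    obtain k c where k: "k \<in> K" "y = k + c \<cdot> w" using decw[OF y] by blast
    have kU: "k \<in> U" using k K by blast
    have MwK: "M w \<in> K" using Mw[OF M] by blast
    have MwU: "M w \<in> U" by (rule into[OF M w(1)])
    have 1: "B k (M w) = 0" using anti[OF B[OF kU] M] Bw[OF k(1)] M by simp
    have 2: "B w (M w) = 0" using Bw[OF MwK] sym[OF w(1) MwU] by simp
    have "B y (M w) = B (M w) (k + c \<cdot> w)" using sym[OF y MwU] k(2) by simp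
    also have "\<dots> = B (M w) k + c \<cdot> B (M w) w"
      by (simp add: add[OF B[OF MwU]] scl[OF B[OF MwU]])
    also have "\<dots> = B k (M w) + c \<cdot> B w (M w)" using sym kU MwU w(1) by simp
    finally show ?thesis using 1 2 by simp
  qed
  have A: "A0 (M w) = 0" if M: "M \<in> L" for M
  proof -
    obtain s y where y: "y \<in> U" "\<forall>u\<in>U. M u = s \<cdot> A0 u + B y u" using repr[OF M] by blast
    have "A0 (M w) = s \<cdot> A0 (A0 w) + A0 (B y w)"
      using y(2) w(1) by (simp add: add[OF A0] scl[OF A0])
    also have "\<dots> = 0"
      using Mw[OF A0] anti[OF A0 B[OF y(1)]] BM[OF y(1) A0] by simp
    finally show ?thesis .
  qed
  have MM: "M' (M w) = 0" if M: "M \<in> L" and M': "M' \<in> L" for M M'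
  proof -
    obtain s y where y: "y \<in> U" "\<forall>u\<in>U. M' u = s \<cdot> A0 u + B y u" using repr[OF M'] by blast
    then show ?thesis using A[OF M] BM[OF y(1) M] into[OF M w(1)] by simp
  qed
  \<comment> \<open>Products of two members kill \<open>w\<close>, so either \<open>w\<close> or
    some nonzero \<open>M w\<close> is the vector sought.\<close>
  show ?thesis
  proof (cases "\<forall>M\<in>L. M w = 0")
    case True
    then show ?thesis using w by blast
  next
    case False
    then obtain M where "M \<in> L" "M w \<noteq> 0" by blast
    then show ?thesis using MM into w(1) by blast
  qed
qed

lemma symmetric_kernel:
  assumes nontriv: "\<exists>u\<in>U. u \<noteq> 0"
  shows common_kernel
proof (cases "\<forall>M\<in>L. \<forall>u\<in>U. \<forall>v\<in>U. M u \<noteq> 0 \<longrightarrow> M v \<in> span {M u}")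
  case True
  then show ?thesis using rank_le_one nontriv by blast
next
  case False
  then obtain N p q where N: "N \<in> L" and pq: "p \<in> U" "q \<in> U" "N p \<noteq> 0" "N q \<notin> span {N p}" by blast
  \<comment> \<open>If \<open>N (N c) \<noteq> 0\<close>, the Jordan chain of \<open>c\<close>
    supplies \<open>a = N c\<close> and \<open>b = c\<close>. Otherwise \<open>N\<close> squares to
    zero on \<open>U\<close> and any pair with independent images will do.\<close>
  obtain a b where ab: "a \<in> U" "b \<in> U" "N a \<noteq> 0" "N (N a) = 0" "N b \<notin> span {N a}"
  proof (cases "\<exists>c\<in>U. N (N c) \<noteq> 0")
    case True
    then obtain c where c: "c \<in> U" "N (N c) \<noteq> 0" by blast
    have "N c \<notin> span {N (N c)}"
    proof
      assume "N c \<in> span {N (N c)}"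
      then obtain t where "N c = t \<cdot> N (N c)" by (auto simp: span_singleton)
      then have "N (N c) = N (t \<cdot> N (N c))" by (rule arg_cong)
      then show False using c scl[OF N] cube[OF N c(1)] by simp
    qed
    then show thesis using that[of "N c" c] c into[OF N] cube[OF N] by blast
  next
    case False
    then show thesis using that[of p q] pq by blast
  qed
  interpret rank_two_member scale U L N a b
    by unfold_locales (use N ab in auto)
  from kernel_or_compression show ?thesis
    unfolding compression_def using compression_kernel by blast
qed

end


section \<open>Passage to the quotient by an invariant subspace\<close>

context infinite_field_space
begin

lemma dep3_image:
  assumes "Vector_Spaces.linear scale scale \<pi>" "dep3 x y z"
  shows "dep3 (\<pi> x) (\<pi> y) (\<pi> z)"
  unfolding dep3_def
proof (intro allI impI)
  fix f1 f2 f3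
  assume f: "Vector_Spaces.linear scale (*) f1" "Vector_Spaces.linear scale (*) f2"
    "Vector_Spaces.linear scale (*) f3"
  note c = Vector_Spaces.linear_compose[OF assms(1)]
  show "det3 (f1 (\<pi> x)) (f2 (\<pi> x)) (f3 (\<pi> x)) (f1 (\<pi> y)) (f2 (\<pi> y)) (f3 (\<pi> y))
      (f1 (\<pi> z)) (f2 (\<pi> z)) (f3 (\<pi> z)) = 0"
    using assms(2)[unfolded dep3_def, rule_format, OF c[OF f(1)] c[OF f(2)] c[OF f(3)]]
    by simp
qed

text \<open>The range of \<open>\<pi>\<close> models the quotient by \<open>W\<close> inside the
  same type. A basis of \<open>W\<close> is sent to 0 and the rest of an extended basis is
  fixed.\<close>

lemma projection_along:
  assumes W: "subspace W"
  shows "\<exists>\<pi>. Vector_Spaces.linear scale scale \<pi> \<and> (\<forall>w\<in>W. \<pi> w = 0) \<and> (\<forall>v. v - \<pi> v \<in> W)"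
proof -
  interpret p: vector_space_pair scale scale by unfold_locales
  obtain B where B: "B \<subseteq> W" "independent B" "W \<subseteq> span B"
    using maximal_independent_subset by blast
  obtain C where C: "B \<subseteq> C" "independent C" "UNIV \<subseteq> span C"
    using maximal_independent_subset_extend[OF subset_UNIV B(2)] by metis
  obtain \<pi> where \<pi>: "Vector_Spaces.linear scale scale \<pi>" "\<forall>x\<in>C. \<pi> x = (if x \<in> B then 0 else x)"
    using p.linear_independent_extend[OF C(2), of "\<lambda>x. if x \<in> B then 0 else x"] by blast
  interpret \<pi>: Vector_Spaces.linear scale scale \<pi> by (rule \<pi>(1))
  have 0: "\<pi> x = 0" if "x \<in> B" for x using that \<pi>(2) C(1) by auto
  show ?thesis
  proof (intro exI[of _ \<pi>] conjI ballI allI)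
    show "Vector_Spaces.linear scale scale \<pi>" by (rule \<pi>(1))
    show "\<pi> w = 0" if "w \<in> W" for w
      using p.linear_eq_0_on_span[OF \<pi>(1) 0, of B w] that B(3) by blast
    show "v - \<pi> v \<in> W" for v
    proof -
      have "v \<in> span C" using C(3) by blast
      then show ?thesis
      proof (induction rule: span_induct_alt)
        case base
        show ?case using subspace_0[OF W] by (simp add: \<pi>.zero)
      next
        case (step c x y)
        have "x - \<pi> x \<in> W" using step(1) \<pi>(2) B(1) subspace_0[OF W] by auto
        then have "c \<cdot> (x - \<pi> x) + (y - \<pi> y) \<in> W"
          using step(2) by (intro subspace_add[OF W] subspace_scale[OF W])
        then show ?case by (simp add: \<pi>.add \<pi>.scale algebra_simps)
      qed
    qed
  qed
qed

end

locale quadratic_family = infinite_field_space scale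
  for scale :: "'a::field \<Rightarrow> 'b::ab_group_add \<Rightarrow> 'b" (infixr \<open>\<cdot>\<close> 75) +
  fixes A0 :: "'b \<Rightarrow> 'b" and B :: "'b \<Rightarrow> 'b \<Rightarrow> 'b"
  assumes A0_add: "A0 (u + v) = A0 u + A0 v" and A0_scale: "A0 (c \<cdot> u) = c \<cdot> A0 u"
    and B_add: "B x (u + v) = B x u + B x v" and B_scale: "B x (c \<cdot> u) = c \<cdot> B x u"
    and B_sym: "B x y = B y x"
    and cube: "M = (\<lambda>u. s \<cdot> A0 u + B x u) \<Longrightarrow> M (M (M u)) = 0"
    and rank: "M = (\<lambda>u. s \<cdot> A0 u + B x u) \<Longrightarrow> dep3 (M u1) (M u2) (M u3)"
begin

lemma invariant_subspace_step:
  assumes W: "subspace W" "W \<noteq> UNIV"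
    and A0W: "\<And>w. w \<in> W \<Longrightarrow> A0 w \<in> W" and BW: "\<And>x w. w \<in> W \<Longrightarrow> B x w \<in> W"
  obtains v where "v \<notin> W" "A0 v \<in> W" "\<And>x. B x v \<in> W"
proof -
  obtain \<pi> where lin: "Vector_Spaces.linear scale scale \<pi>" and \<pi>0: "\<And>w. w \<in> W \<Longrightarrow> \<pi> w = 0"
    and \<pi>W: "\<And>v. v - \<pi> v \<in> W"
    using projection_along[OF W(1)] by blast
  interpret \<pi>: Vector_Spaces.linear scale scale \<pi> by (rule lin)
  define U where "U = range \<pi>"
  have U: "subspace U" unfolding U_def by (rule \<pi>.subspace_image) simp
  have idem: "\<pi> (\<pi> v) = \<pi> v" for v
    using \<pi>0[OF \<pi>W, of v] by (simp add: \<pi>.diff)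
  have \<pi>U: "\<pi> u = u" if "u \<in> U" for u using that idem by (auto simp: U_def)
  define M where "M s x u = s \<cdot> A0 u + B x u" for s x u
  have M_add: "M s x (u + v) = M s x u + M s x v" and M_scale: "M s x (c \<cdot> u) = c \<cdot> M s x u" for s x u v c
    by (simp_all add: M_def A0_add A0_scale B_add B_scale algebra_simps)
  have B_add1: "B (x + y) u = B x u + B y u" and B_scale1: "B (c \<cdot> x) u = c \<cdot> B x u" for x y u c
    using B_add[of u x y] B_scale[of u c x] B_sym[of u] by simp_all
  have MW: "M s x w \<in> W" if "w \<in> W" for s x w
    using that A0W BW W(1) by (simp add: M_def subspace_add subspace_scale)
  \<comment> \<open>Replacing \<open>u\<close> by \<open>\<pi> u\<close> changes the value only by
    an element of the invariant \<open>W\<close>. Hence composites of compressed maps are compressed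
    composites, and the cubes still vanish.\<close>
  have \<pi>M: "\<pi> (M s x (\<pi> u)) = \<pi> (M s x u)" for s x u
  proof -
    have "M s x u = M s x (u - \<pi> u) + M s x (\<pi> u)" using M_add[of s x "u - \<pi> u" "\<pi> u"] by simp
    then show ?thesis using \<pi>0[OF MW[OF \<pi>W]] by (simp add: \<pi>.add)
  qed
  define L where "L = {\<lambda>u. \<pi> (M s x u) | s x. x \<in> U}"
  have in_L: "(\<lambda>u. \<pi> (M s x u)) \<in> L" if "x \<in> U" for s x using that by (auto simp: L_def)
  have LE: "\<exists>s x. x \<in> U \<and> N = (\<lambda>u. \<pi> (M s x u))" if "N \<in> L" for N using that by (auto simp: L_def)
  interpret symmetric_family scale U L "\<lambda>u. \<pi> (A0 u)" "\<lambda>x u. \<pi> (B x u)"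
  proof unfold_locales
    show "subspace U" by (rule U)
    show "(\<lambda>u. \<pi> (A0 u)) \<in> L" using in_L[OF subspace_0[OF U], of 1] B_scale1[of 0 0] by (simp add: M_def)
    show "(\<lambda>u. \<pi> (B x u)) \<in> L" if "x \<in> U" for x using in_L[OF that, of 0] by (simp add: M_def)
    show "\<pi> (B x y) = \<pi> (B y x)" for x y by (simp add: B_sym)
    fix N assume "N \<in> L"
    then obtain s x where x: "x \<in> U" and N: "N = (\<lambda>u. \<pi> (M s x u))" using LE by blast
    show "N (u + v) = N u + N v" and "N (c \<cdot> u) = c \<cdot> N u" for u v c
      by (simp_all add: N M_add M_scale \<pi>.add \<pi>.scale)
    show "N u \<in> U" for u by (simp add: N U_def)
    show "N (N (N u)) = 0" for u
    proof -
      have "M s x (M s x (M s x u)) = 0" by (rule cube[of _ s x]) (simp add: M_def fun_eq_iff)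
      then show ?thesis by (simp add: N \<pi>M \<pi>.zero)
    qed
    show "dep3 (N u1) (N u2) (N u3)" for u1 u2 u3
      unfolding N by (rule dep3_image[OF lin], rule rank[of _ s x]) (simp add: M_def fun_eq_iff)
    show "\<exists>s. \<exists>x\<in>U. \<forall>u\<in>U. N u = s \<cdot> \<pi> (A0 u) + \<pi> (B x u)"
      using x by (intro exI[of _ s] bexI[of _ x]) (simp_all add: N M_def \<pi>.add \<pi>.scale)
    fix N' c assume "N' \<in> L"
    then obtain s' x' where x': "x' \<in> U" and N': "N' = (\<lambda>u. \<pi> (M s' x' u))" using LE by blast
    have "(\<lambda>u. N u + c \<cdot> N' u) = (\<lambda>u. \<pi> (M (s + c * s') (x + c \<cdot> x') u))"
      by (simp add: N N' M_def B_add1 B_scale1 \<pi>.add \<pi>.scale algebra_simps)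
    then show "(\<lambda>u. N u + c \<cdot> N' u) \<in> L"
      using in_L[of "x + c \<cdot> x'"] x x' U by (simp add: subspace_add subspace_scale)
  qed
  obtain p where "p \<notin> W" using W(2) by blast
  then have "\<pi> p \<noteq> 0" using \<pi>W[of p] by auto
  then have "\<exists>u\<in>U. u \<noteq> 0" by (auto simp: U_def)
  then obtain v where v: "v \<in> U" "v \<noteq> 0" "\<forall>N\<in>L. N v = 0" 
    using symmetric_kernel[OF \<open>\<exists>u\<in>U. u \<noteq> 0\<close>] by (elim bexE conjE)
  have in_W: "y \<in> W" if "\<pi> y = 0" for y using \<pi>W[of y] that by simp
  show thesis
  proof
    show "v \<notin> W" using \<pi>0[of v] \<pi>U[OF v(1)] v(2) by auto
    show "A0 v \<in> W" by (rule in_W) (rule bspec[OF v(3) A0])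
    fix x
    have "\<pi> x \<in> U" by (simp add: U_def)
    have "\<pi> (B (\<pi> x) v) = 0" by (rule bspec[OF v(3) B[OF \<open>\<pi> x \<in> U\<close>]])
    then have "B (\<pi> x) v \<in> W" by (rule in_W)
    \<comment> \<open>The compressed family covers only parameters in the range of
      \<open>\<pi>\<close>. A parameter in \<open>W\<close> is turned into the argument by symmetry,
      and invariance of \<open>W\<close> applies.\<close>
    moreover have "B (x - \<pi> x) v \<in> W" using BW[OF \<pi>W, of v x] B_sym by metis
    ultimately have "B (\<pi> x) v + B (x - \<pi> x) v \<in> W" by (rule subspace_add[OF W(1)])
    then show "B x v \<in> W" using B_add1[of "\<pi> x" "x - \<pi> x" v] by simp
  qed
qed

end


subsection \<open>Simultaneous triangularization\<close>

fun word_apply :: "('i \<Rightarrow> 'a::field^'n^'n) \<Rightarrow> 'i list \<Rightarrow> 'a^'n \<Rightarrow> 'a^'n" where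
  "word_apply A [] v = v"
| "word_apply A (i # ws) v = A i *v word_apply A ws v"

lemma word_apply_append: "word_apply A (us @ ws) v = word_apply A us (word_apply A ws v)"
  by (induction us) auto

lemma word_apply_linear [simp]:
  "word_apply A ws 0 = 0"
  "word_apply A ws (u + v) = word_apply A ws u + word_apply A ws v"
  "word_apply A ws (c *s v) = c *s word_apply A ws v"
  by (induction ws) (auto simp: vec.add vec.scale matrix_vector_right_distrib)

text \<open>Unlike the existence of a common flag, this condition visibly descends along a field extension.\<close>

definition jointly_nilpotent :: "('i \<Rightarrow> 'a::field^'n^'n) \<Rightarrow> bool" where
  "jointly_nilpotent A \<longleftrightarrow> (\<forall>v. \<exists>m. \<forall>ws. m \<le> length ws \<longrightarrow> word_apply A ws v = 0)"

text \<open>The vectors killed by all sufficiently long words form an invariant subspace. It also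
  contains every vector that all matrices map into it, since finitely many bounds have a maximum; so
  it cannot be proper.\<close>

lemma jointly_nilpotent_if_step:
  fixes A :: "'i::finite \<Rightarrow> 'a::field^'n^'n"
  assumes step: "\<And>W. vec.subspace W \<Longrightarrow> W \<noteq> UNIV \<Longrightarrow> (\<And>i w. w \<in> W \<Longrightarrow> A i *v w \<in> W) \<Longrightarrow>
    \<exists>v. v \<notin> W \<and> (\<forall>i. A i *v v \<in> W)"
  shows "jointly_nilpotent A"
proof -
  define W where "W = {v. \<exists>m. \<forall>ws. m \<le> length ws \<longrightarrow> word_apply A ws v = 0}"
  have sub: "vec.subspace W"
  proof (rule vec.subspaceI)
    show "0 \<in> W" by (auto simp: W_def)
    show "u + v \<in> W" if uv: "u \<in> W" "v \<in> W" for u v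
    proof -
      obtain m m' where "\<forall>ws. m \<le> length ws \<longrightarrow> word_apply A ws u = 0"
        "\<forall>ws. m' \<le> length ws \<longrightarrow> word_apply A ws v = 0"
        using uv by (auto simp: W_def)
      then show ?thesis by (auto simp: W_def intro!: exI[of _ "max m m'"])
    qed
    show "c *s v \<in> W" if "v \<in> W" for c v
      using that by (auto simp: W_def)
  qed
  have inv: "A i *v w \<in> W" if w: "w \<in> W" for i w
  proof -
    obtain m where m: "\<forall>ws. m \<le> length ws \<longrightarrow> word_apply A ws w = 0"
      using w by (auto simp: W_def)
    have "word_apply A ws (A i *v w) = 0" if "m \<le> length ws" for ws
      using m[rule_format, of "ws @ [i]"] that by (simp add: word_apply_append)
    then show ?thesis by (auto simp: W_def)
  qed
  have "W = UNIV"
  proof (rule ccontr)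
    assume "W \<noteq> UNIV"
    then obtain v where v: "v \<notin> W" "\<forall>i. A i *v v \<in> W" using step[OF sub _ inv] by blast
    then have "\<forall>i. \<exists>m. \<forall>ws. m \<le> length ws \<longrightarrow> word_apply A ws (A i *v v) = 0"
      by (auto simp: W_def)
    then obtain m where m: "\<And>i ws. m i \<le> length ws \<Longrightarrow> word_apply A ws (A i *v v) = 0" by metis
    \<comment> \<open>The additional letter is the last one of the word: it acts first and moves
      \<open>v\<close> into \<open>W\<close>.\<close>
    have "word_apply A ws v = 0" if len: "Suc (Max (range m)) \<le> length ws" for ws
    proof -
      obtain us i where ws: "ws = us @ [i]" using len by (cases ws rule: rev_cases) auto
      have "m i \<le> Max (range m)" by simp
      then have "m i \<le> length us" using len ws by simp
      then show ?thesis using m by (simp add: ws word_apply_append)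
    qed
    then show False using v(1) by (auto simp: W_def)
  qed
  then show ?thesis by (auto simp: W_def jointly_nilpotent_def)
qed

text \<open>Otherwise each vector outside \<open>S\<close> could be moved to another one outside
  \<open>S\<close>, giving words of every length with nonzero value at \<open>v\<close>.\<close>

lemma jointly_nilpotent_step:
  fixes A :: "'i \<Rightarrow> 'a::field^'n^'n"
  assumes nil: "jointly_nilpotent A" and S: "vec.subspace S" "S \<noteq> UNIV"
  shows "\<exists>v. v \<notin> S \<and> (\<forall>i. A i *v v \<in> S)"
proof (rule ccontr)
  assume neg: "\<not> ?thesis"
  obtain v where v: "v \<notin> S" using S(2) by blast
  have "\<exists>ws. length ws = m \<and> word_apply A ws v \<notin> S" for m
  proof (induction m)
    case 0
    then show ?case using v by (intro exI[of _ "[]"]) simp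
  next
    case (Suc m)
    then obtain ws where ws: "length ws = m" "word_apply A ws v \<notin> S" by blast
    then obtain i where "A i *v word_apply A ws v \<notin> S" using neg by blast
    then show ?case using ws by (intro exI[of _ "i # ws"]) simp
  qed
  moreover obtain m where "\<forall>ws. m \<le> length ws \<longrightarrow> word_apply A ws v = 0"
    using nil by (auto simp: jointly_nilpotent_def)
  ultimately show False using vec.subspace_0[OF S(1)] by (metis order_refl)
qed

lemma matrix_entry_axis:
  fixes A :: "'a::field^'n^'m"
  shows "A $ i $ j = (A *v axis j 1) $ i"
  by (simp add: matrix_vector_mult_def axis_def if_distrib[of "\<lambda>z. _ * z"] cong: if_cong)

text \<open>Indexing by the ordered type \<open>'n\<close> makes the vectors usable as matrix
  columns. They are chosen in increasing order, each outside the span of the earlier ones but mapped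
  into it.\<close>

lemma triangular_basis:
  fixes A :: "'i \<Rightarrow> (('a::field, 'n::{finite,linorder}) vec, 'n) vec"
  assumes nil: "jointly_nilpotent A"
  shows "\<exists>x :: 'n \<Rightarrow> ('a, 'n) vec. inj x \<and> vec.independent (range x) \<and>
    (\<forall>i j. A i *v x j \<in> vec.span (x ` {..<j}))"
proof -
  have "\<exists>x :: 'n \<Rightarrow> ('a, 'n) vec. inj_on x S \<and> vec.independent (x ` S) \<and>
    (\<forall>j\<in>S. \<forall>i. A i *v x j \<in> vec.span (x ` {k\<in>S. k < j}))" if "finite S" for S :: "'n set"
    using that
  proof (induction S rule: finite_linorder_max_induct)
    case empty
    show ?case by (simp add: vec.independent_empty)
  next
    case (insert b S)
    then obtain x :: "'n \<Rightarrow> ('a, 'n) vec" where x: "inj_on x S" "vec.independent (x ` S)"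
      "\<And>j i. j \<in> S \<Longrightarrow> A i *v x j \<in> vec.span (x ` {k\<in>S. k < j})" by blast
    have b: "b \<notin> S" using insert.hyps by auto
    have "vec.dim (vec.span (x ` S)) = card S"
      by (simp add: vec.dim_span vec.dim_eq_card_independent x card_image)
    also have "\<dots> < card (UNIV :: 'n set)"
      using b by (intro psubset_card_mono) auto
    also have "\<dots> = vec.dim (UNIV :: ('a, 'n) vec set)" by (simp only: vec_dim_card)
    finally have "vec.span (x ` S) \<noteq> UNIV" by force
    then obtain v where v: "v \<notin> vec.span (x ` S)" "\<And>i. A i *v v \<in> vec.span (x ` S)"
      using jointly_nilpotent_step[OF nil vec.subspace_span] by blast
    define y where "y = x(b := v)"
    have yx: "y j = x j" if "j \<in> S" for j using that b by (auto simp: y_def)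
    have yb: "y b = v" by (simp add: y_def)
    have img: "y ` S = x ` S" using yx by (simp cong: image_cong)
    have vn: "v \<notin> x ` S" using v(1) vec.span_base by blast
    have "inj_on y (insert b S)"
    proof -
      have "inj_on y S" using x(1) inj_on_cong[of S y x] yx by blast
      then show ?thesis using vn b by (simp add: yb img)
    qed
    moreover have "vec.independent (y ` insert b S)"
      by (simp add: img yb vec.independent_insertI[OF v(1) x(2)])
    moreover have "A i *v y j \<in> vec.span (y ` {k\<in>insert b S. k < j})" if j: "j \<in> insert b S" for i j
    proof (cases "j = b")
      case True
      then have "{k\<in>insert b S. k < j} = S" using insert.hyps by auto
      then show ?thesis using True v(2) by (simp add: yb img)
    next
      case False
      then have jS: "j \<in> S" using j by simp
      then have "{k\<in>insert b S. k < j} = {k\<in>S. k < j}" using insert.hyps by auto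
      moreover have "y ` {k\<in>S. k < j} = x ` {k\<in>S. k < j}" using yx by (intro image_cong) auto
      ultimately show ?thesis using x(3)[OF jS] yx[OF jS] by simp
    qed
    ultimately show ?case by blast
  qed
  from this[of UNIV] obtain x :: "'n \<Rightarrow> ('a, 'n) vec" where x: "inj x" "vec.independent (range x)"
    "\<forall>j i. A i *v x j \<in> vec.span (x ` {k. k < j})" by auto
  then show ?thesis by (intro exI[of _ x]) (simp add: lessThan_def)
qed

lemma triangularize:
  fixes A :: "'i \<Rightarrow> (('a::field, 'n::{finite,linorder}) vec, 'n) vec"
  assumes nil: "jointly_nilpotent A"
  shows "\<exists>T :: (('a, 'n) vec, 'n) vec. invertible T \<and>
    (\<forall>i r c. c \<le> r \<longrightarrow> (matrix_inv T ** A i ** T) $ r $ c = 0)"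
proof -
  obtain x :: "'n \<Rightarrow> ('a, 'n) vec" where x: "inj x" "vec.independent (range x)"
    "\<And>i j. A i *v x j \<in> vec.span (x ` {..<j})" using triangular_basis[OF nil] by blast
  define T :: "(('a, 'n) vec, 'n) vec" where "T = (\<chi> r c. x c $ r)"
  have Tv: "T *v y = (\<Sum>c\<in>UNIV. y $ c *s x c)" for y
    by (simp add: T_def matrix_vector_mult_def vec_eq_iff mult.commute)
  have T_axis: "T *v axis c 1 = x c" for c
    by (simp add: Tv vec_eq_iff axis_def if_distrib[of "\<lambda>z. z * _"] cong: if_cong)
  have "y = 0" if "T *v y = 0" for y
  proof -
    have s: "(\<Sum>v\<in>range x. y $ (inv x v) *s v) = 0"
      using that x(1) by (simp add: Tv sum.reindex)
    have "y $ (inv x (x c)) = 0" for c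
      by (rule vec.independentD[where u = "\<lambda>v. y $ inv x v", OF x(2) finite_imageI[OF finite] subset_refl s]) simp
    then have "y $ c = 0" for c using x(1) by (simp add: inv_f_f)
    then show ?thesis by (simp add: vec_eq_iff)
  qed
  then have inv: "invertible T"
    using matrix_left_invertible_ker[of T] invertible_left_inverse[of T] by blast
  have tri: "(matrix_inv T ** A i ** T) $ r $ c = 0" if rc: "c \<le> r" for i r c
  proof -
    \<comment> \<open>\<open>Q\<close> is the span of the columns before \<open>c\<close> in
      coordinates, so membership of \<open>A i *v x c\<close> bounds the support of its coordinate
      vector.\<close>
    define Q where "Q = {T *v y | y. \<forall>k\<ge>c. y $ k = 0}"
    have "vec.subspace Q"
    proof (rule vec.subspaceI)
      show "0 \<in> Q" unfolding Q_def by (intro CollectI exI[of _ 0]) simp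
      show "u + v \<in> Q" if "u \<in> Q" "v \<in> Q" for u v
      proof -
        obtain y z where "u = T *v y" "\<forall>k\<ge>c. y $ k = 0" "v = T *v z" "\<forall>k\<ge>c. z $ k = 0"
          using \<open>u \<in> Q\<close> \<open>v \<in> Q\<close> by (auto simp: Q_def)
        then show ?thesis unfolding Q_def
          by (intro CollectI exI[of _ "y + z"]) (simp add: matrix_vector_right_distrib)
      qed
      show "a *s v \<in> Q" if "v \<in> Q" for a v
      proof -
        obtain z where "v = T *v z" "\<forall>k\<ge>c. z $ k = 0" using \<open>v \<in> Q\<close> by (auto simp: Q_def)
        then show ?thesis unfolding Q_def
          by (intro CollectI exI[of _ "a *s z"]) (simp add: vec.scale)
      qed
    qed
    moreover have "x ` {..<c} \<subseteq> Q"
    proof (rule image_subsetI)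
      fix j assume "j \<in> {..<c}"
      then show "x j \<in> Q" unfolding Q_def
        by (intro CollectI exI[of _ "axis j 1"] conjI) (simp add: T_axis, auto simp: axis_def)
    qed
    ultimately have "vec.span (x ` {..<c}) \<subseteq> Q" by (rule vec.span_minimal[rotated])
    then have "A i *v x c \<in> Q" using x(3) by blast
    then obtain y where y: "A i *v x c = T *v y" "y $ r = 0"
      using rc by (auto simp: Q_def)
    have "(matrix_inv T ** A i ** T) *v axis c 1 = matrix_inv T *v (A i *v x c)"
      by (simp add: matrix_vector_mul_assoc[symmetric] T_axis)
    also have "\<dots> = (matrix_inv T ** T) *v y"
      by (simp only: y matrix_vector_mul_assoc[symmetric])
    also have "\<dots> = y" using someI_ex[OF inv[unfolded invertible_def]] by (simp add: matrix_inv_def)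
    finally show ?thesis using y(2) by (metis matrix_entry_axis)
  qed
  show ?thesis using inv tri by blast
qed


section \<open>From nilpotent affine families to homogeneous ones\<close>

context infinite_field_space
begin

lemma quadratic_vector_polynomial_limit:
  assumes "\<And>t. t \<noteq> 0 \<Longrightarrow> a + t \<cdot> x + (t * t) \<cdot> y = 0"
  shows "a = 0"
proof (rule ccontr)
  assume "a \<noteq> 0"
  then obtain f where f: "Vector_Spaces.linear scale (*) f" "f a = 1"
    using separating_functional[of "{0}" a] by auto
  note s = functional_simps[OF f(1)]
  have "[:f a, f x, f y:] = 0"
  proof (rule poly_eq_0_of_infinite[OF infinite_field])
    fix t :: 'a assume "t \<noteq> 0"
    from arg_cong[OF assms[OF this], of f] show "poly [:f a, f x, f y:] t = 0"
      by (simp add: s algebra_simps)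
  qed
  then show False using f(2) by simp
qed

text \<open>In a Jordan chain of length at least four, the last three vectors are independent and
  all are values of \<open>M\<close>, against rank at most two.\<close>

lemma cube_eq_0_of_nilpotent:
  assumes add: "\<And>u v. M (u + v) = M u + M v" and scl: "\<And>c u. M (c \<cdot> u) = c \<cdot> M u"
    and nil: "(M ^^ r) u = 0"
    and rank: "\<And>u1 u2 u3. dep3 (M u1) (M u2) (M u3)"
  shows "M (M (M u)) = 0"
proof (rule ccontr)
  assume n: "M (M (M u)) \<noteq> 0"
  have M0: "M 0 = 0" using scl[of 0 0] by simp
  define k where "k = (LEAST k. (M ^^ k) u = 0)"
  have k: "(M ^^ k) u = 0" unfolding k_def using nil by (rule LeastI)
  have less: "(M ^^ j) u \<noteq> 0" if "j < k" for j
    using not_less_Least that unfolding k_def by blast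
  have "u \<noteq> 0" using n M0 by auto
  then have "k \<noteq> 0" using k by (cases k) auto
  moreover have "k \<noteq> 1" "k \<noteq> 2" "k \<noteq> 3"
    using k n M0 by (auto simp: numeral_eq_Suc)
  ultimately obtain l where l: "k = Suc (Suc (Suc (Suc l)))"
    by (metis One_nat_def Suc_1 numeral_3_eq_3 not0_implies_Suc)
  define v where "v = (M ^^ l) u"
  have Mx: "M (M (M (M v))) = 0" using k by (simp add: l v_def)
  have x: "M (M (M v)) \<noteq> 0" using less[of "Suc (Suc (Suc l))"] by (simp add: l v_def)
  have y: "M (M v) \<notin> span {M (M (M v))}"
  proof
    assume "M (M v) \<in> span {M (M (M v))}"
    then obtain c where "M (M v) = c \<cdot> M (M (M v))" by (auto simp: span_singleton)
    from arg_cong[OF this, of M] show False using x by (simp add: scl Mx)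
  qed
  have "M v \<in> span (insert (M (M (M v))) {M (M v)})"
    using dep3_cases[OF rank x y, of v] by simp
  then obtain c where "M v - c \<cdot> M (M (M v)) \<in> span {M (M v)}" by (auto simp: span_breakdown_eq)
  then obtain d where "M v - c \<cdot> M (M (M v)) = d \<cdot> M (M v)" by (auto simp: span_singleton)
  then have "M v = c \<cdot> M (M (M v)) + d \<cdot> M (M v)" by (simp add: algebra_simps)
  from arg_cong[OF this, of M] have "M (M v) = d \<cdot> M (M (M v))" by (simp add: add scl Mx)
  then show False using y by (auto simp: span_singleton)
qed

text \<open>The hypotheses concern the maps \<open>A0 + B x\<close> only; homogenizing means to pass to the linear
  family \<open>s A0 + B x\<close>, where \<open>s = 0\<close> is a limit case.\<close>

lemma quadratic_familyI:
  assumes A0_add: "\<And>u v. A0 (u + v) = A0 u + A0 v" and A0_scale: "\<And>c u. A0 (c \<cdot> u) = c \<cdot> A0 u"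
    and B_add: "\<And>x u v. B x (u + v) = B x u + B x v" and B_scale: "\<And>x c u. B x (c \<cdot> u) = c \<cdot> B x u"
    and B_sym: "\<And>x y. B x y = B y x"
    and nil: "\<And>x u. \<exists>r. ((\<lambda>u. A0 u + B x u) ^^ r) u = 0"
    and rank: "\<And>x u1 u2 u3. dep3 (A0 u1 + B x u1) (A0 u2 + B x u2) (A0 u3 + B x u3)"
  shows "quadratic_family scale A0 B"
proof -
  define M where "M s x u = s \<cdot> A0 u + B x u" for s x u
  have M_add: "M s x (u + v) = M s x u + M s x v" and M_scale: "M s x (c \<cdot> u) = c \<cdot> M s x u" for s x u v c
    by (simp_all add: M_def A0_add A0_scale B_add B_scale algebra_simps)
  have M1: "A0 u + B x u = M 1 x u" for x u by (simp add: M_def)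
  have B_scale1: "B (c \<cdot> x) u = c \<cdot> B x u" for x u c
    using B_scale[of u c x] B_sym[of u] by simp
  have cube1: "M 1 x (M 1 x (M 1 x u)) = 0" for x u
  proof -
    obtain r where "(M 1 x ^^ r) u = 0" using nil[where x=x and u=u] unfolding M1 by blast
    then show ?thesis
      by (rule cube_eq_0_of_nilpotent[where M="M 1 x", OF M_add M_scale _ rank[unfolded M1]])
  qed
  \<comment> \<open>For \<open>s \<noteq> 0\<close> the member is a multiple of the one at the
    rescaled point with \<open>s = 1\<close>.\<close>
  have Ms: "M s x u = s \<cdot> M 1 (inverse s \<cdot> x) u" if "s \<noteq> 0" for s x u
    using that by (simp add: M_def B_scale1 scale_right_distrib)
  have cube_s: "M s x (M s x (M s x u)) = 0" if "s \<noteq> 0" for s x u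
    by (simp add: Ms[OF that] M_scale cube1)
  have dep_s: "dep3 (M s x u1) (M s x u2) (M s x u3)" if "s \<noteq> 0" for s x u1 u2 u3
  proof -
    have "dep3 (M 1 (inverse s \<cdot> x) (s \<cdot> u1)) (M 1 (inverse s \<cdot> x) (s \<cdot> u2)) (M 1 (inverse s \<cdot> x) (s \<cdot> u3))"
      by (rule rank[unfolded M1])
    then show ?thesis by (simp add: Ms[OF that] M_scale)
  qed
  have M0: "M t x u = M 0 x u + t \<cdot> A0 u" for t x u by (simp add: M_def)
  have dep: "dep3 (M s x u1) (M s x u2) (M s x u3)" for s x u1 u2 u3
  proof (cases "s = 0")
    case True
    have "dep3 (M 0 x u1 + t \<cdot> A0 u1) (M 0 x u2 + t \<cdot> A0 u2) (M 0 x u3 + t \<cdot> A0 u3)" if "t \<noteq> 0" for t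
      using dep_s[OF that, of x u1 u2 u3] by (simp only: M0[of t, symmetric])
    then show ?thesis unfolding True by (rule dep3_limit)
  qed (rule dep_s)
  have A0_cube: "A0 (A0 (A0 u)) = 0" for u
    using cube1[of 0 u] B_scale1[of 0 0] by (simp add: M_def)
  have cube: "M s x (M s x (M s x u)) = 0" for s x u
  proof (cases "s = 0")
    case True
    define N where "N = M 0 x"
    have N: "N (u + v) = N u + N v" "N (c \<cdot> u) = c \<cdot> N u" for u v c
      by (simp_all add: N_def M_add M_scale)
    \<comment> \<open>In the expansion of \<open>(N + t A0)^3\<close> the coefficient of
      \<open>t^3\<close> is \<open>A0^3 = 0\<close>, so only a quadratic polynomial in
      \<open>t\<close> has to be treated.\<close>
    have "N (N (N u)) = 0"
    proof (rule quadratic_vector_polynomial_limit)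
      fix t :: 'a assume t: "t \<noteq> 0"
      have MN: "M t x v = N v + t \<cdot> A0 v" for v by (simp add: N_def M0[of t])
      have "N (N (N u)) + t \<cdot> (N (N (A0 u)) + N (A0 (N u)) + A0 (N (N u)))
          + (t * t) \<cdot> (N (A0 (A0 u)) + A0 (N (A0 u)) + A0 (A0 (N u))) = M t x (M t x (M t x u))"
        by (simp add: MN N A0_add A0_scale A0_cube algebra_simps)
      then show "N (N (N u)) + t \<cdot> (N (N (A0 u)) + N (A0 (N u)) + A0 (N (N u)))
          + (t * t) \<cdot> (N (A0 (A0 u)) + A0 (N (A0 u)) + A0 (A0 (N u))) = 0"
        using cube_s[OF t] by simp
    qed
    then show ?thesis by (simp add: N_def True)
  qed (rule cube_s)
  show ?thesis
    by unfold_locales (use A0_add A0_scale B_add B_scale B_sym cube dep in \<open>simp_all add: M_def\<close>)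
qed

end

section \<open>Matrix families over an infinite field\<close>

definition bilinear_part :: "('n \<Rightarrow> 'a::field^'n^'n) \<Rightarrow> 'a^'n \<Rightarrow> 'a^'n \<Rightarrow> 'a^'n"
  where "bilinear_part A x v = (\<Sum>k\<in>UNIV. x $ k *s (A k *v v))"

lemma bilinear_part_axis: "bilinear_part A (axis k 1) v = A k *v v"
proof -
  have "bilinear_part A (axis k 1) v = (\<Sum>l\<in>UNIV. if l = k then A l *v v else 0)"
    unfolding bilinear_part_def by (rule sum.cong) (auto simp: axis_def)
  then show ?thesis by simp
qed

lemma bilinear_part_sym:
  assumes "\<And>i j k. A k $ i $ j = A j $ i $ k"
  shows "bilinear_part A x y = bilinear_part A y x"
proof -
  have "bilinear_part A x y $ i = bilinear_part A y x $ i" for i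
  proof -
    have "bilinear_part A x y $ i = (\<Sum>k\<in>UNIV. \<Sum>l\<in>UNIV. x $ k * (A k $ i $ l * y $ l))" for x y
      by (simp add: bilinear_part_def matrix_vector_mult_def sum_distrib_left)
    moreover have "(\<Sum>k\<in>UNIV. \<Sum>l\<in>UNIV. x $ k * (A k $ i $ l * y $ l)) =
      (\<Sum>l\<in>UNIV. \<Sum>k\<in>UNIV. y $ l * (A l $ i $ k * x $ k))"
      by (subst sum.swap, intro sum.cong refl) (simp add: assms[of _ i] ac_simps)
    ultimately show ?thesis by simp
  qed
  then show ?thesis by (simp add: vec_eq_iff)
qed

lemma det3_linear_combination:
  fixes f :: "'i \<Rightarrow> 'a::comm_ring_1"
  assumes "\<And>i. i \<in> I \<Longrightarrow> det3 (x i) (y i) (z i) d e f' g h k = 0"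
  shows "det3 (\<Sum>i\<in>I. f i * x i) (\<Sum>i\<in>I. f i * y i) (\<Sum>i\<in>I. f i * z i) d e f' g h k = 0"
proof -
  have "(\<Sum>i\<in>I. f i * x i) * A - (\<Sum>i\<in>I. f i * y i) * B + (\<Sum>i\<in>I. f i * z i) * C
    = (\<Sum>i\<in>I. f i * (x i * A - y i * B + z i * C))" for A B C
    by (simp add: sum_distrib_right right_diff_distrib distrib_left sum.distrib sum_subtractf mult.assoc)
  then show ?thesis using assms by (simp add: det3_def)
qed

lemma det3_rotate: "det3 a b c d e f g h i = det3 d e f g h i a b c"
  by (simp add: det3_def algebra_simps)

lemma det3_transpose: "det3 a b c d e f g h i = det3 a d g b e h c f i"
  by (simp add: det3_def algebra_simps)

lemma det3_linear_combination2:
  fixes f :: "'i \<Rightarrow> 'a::comm_ring_1"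
  assumes "\<And>i. i \<in> I \<Longrightarrow> det3 a b c (x i) (y i) (z i) g h k = 0"
  shows "det3 a b c (\<Sum>i\<in>I. f i * x i) (\<Sum>i\<in>I. f i * y i) (\<Sum>i\<in>I. f i * z i) g h k = 0"
  using det3_linear_combination[of I x y z g h k a b c f] assms by (simp add: det3_rotate[of a])

lemma det3_linear_combination3:
  fixes f :: "'i \<Rightarrow> 'a::comm_ring_1"
  assumes "\<And>i. i \<in> I \<Longrightarrow> det3 a b c d e f' (x i) (y i) (z i) = 0"
  shows "det3 a b c d e f' (\<Sum>i\<in>I. f i * x i) (\<Sum>i\<in>I. f i * y i) (\<Sum>i\<in>I. f i * z i) = 0"
  using det3_linear_combination2[of I d e f' x y z a b c f] assms by (simp add: det3_rotate[of a])

text \<open>Each \<open>P *v u\<close> is a combination of columns of \<open>P\<close>; the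
  determinant expands multilinearly into 3 by 3 minors.\<close>

lemma det3_rows:
  fixes P :: "'a::field^'n^'n"
  assumes minors: "\<And>i1 i2 i3 j1 j2 j3. det3 (P $ i1 $ j1) (P $ i1 $ j2) (P $ i1 $ j3)
    (P $ i2 $ j1) (P $ i2 $ j2) (P $ i2 $ j3) (P $ i3 $ j1) (P $ i3 $ j2) (P $ i3 $ j3) = 0"
  shows "det3 ((P *v u1) $ i1) ((P *v u1) $ i2) ((P *v u1) $ i3)
    ((P *v u2) $ i1) ((P *v u2) $ i2) ((P *v u2) $ i3)
    ((P *v u3) $ i1) ((P *v u3) $ i2) ((P *v u3) $ i3) = 0"
proof -
  have e: "(P *v u) $ i = (\<Sum>j\<in>UNIV. u $ j * P $ i $ j)" for u i
    by (simp add: matrix_vector_mult_def mult.commute)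
  have 1: "det3 (P $ i1 $ j1) (P $ i2 $ j1) (P $ i3 $ j1) (P $ i1 $ j2) (P $ i2 $ j2) (P $ i3 $ j2)
    (P $ i1 $ j3) (P $ i2 $ j3) (P $ i3 $ j3) = 0" for j1 j2 j3
    by (subst det3_transpose) (rule minors)
  have 2: "det3 ((P *v u1) $ i1) ((P *v u1) $ i2) ((P *v u1) $ i3) (P $ i1 $ j2) (P $ i2 $ j2) (P $ i3 $ j2)
    (P $ i1 $ j3) (P $ i2 $ j3) (P $ i3 $ j3) = 0" for j2 j3
    unfolding e by (rule det3_linear_combination) (rule 1)
  have 3: "det3 ((P *v u1) $ i1) ((P *v u1) $ i2) ((P *v u1) $ i3)
    ((P *v u2) $ i1) ((P *v u2) $ i2) ((P *v u2) $ i3)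
    (P $ i1 $ j3) (P $ i2 $ j3) (P $ i3 $ j3) = 0" for j3
    unfolding e[of u2] by (rule det3_linear_combination2) (rule 2)
  show ?thesis
    unfolding e[of u3] by (rule det3_linear_combination3) (rule 3)
qed

text \<open>A functional is a combination of coordinates. Together with \<open>det3_rows\<close>
  this turns vanishing minors into \<open>dep3\<close>.\<close>

lemma det3_functionals:
  fixes x y z :: "'a::field^'n"
  assumes coord: "\<And>i1 i2 i3. det3 (x $ i1) (x $ i2) (x $ i3) (y $ i1) (y $ i2) (y $ i3)
    (z $ i1) (z $ i2) (z $ i3) = 0"
    and f: "Vector_Spaces.linear (*s) (*) f1" "Vector_Spaces.linear (*s) (*) f2"
      "Vector_Spaces.linear (*s) (*) f3"
  shows "det3 (f1 x) (f2 x) (f3 x) (f1 y) (f2 y) (f3 y) (f1 z) (f2 z) (f3 z) = 0"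
proof -
  have e: "f v = (\<Sum>i\<in>UNIV. f (axis i 1) * v $ i)" if "Vector_Spaces.linear (*s) (*) f"
    for f :: "'a^'n \<Rightarrow> 'a" and v
  proof -
    interpret Vector_Spaces.linear "(*s)" "(*)" f by (rule that)
    have "f v = f (\<Sum>i\<in>UNIV. v $ i *s axis i 1)" by (simp add: basis_expansion)
    also have "\<dots> = (\<Sum>i\<in>UNIV. f (axis i 1) * v $ i)" by (simp add: sum scale mult.commute)
    finally show ?thesis .
  qed
  have 1: "det3 (x $ i1) (y $ i1) (z $ i1) (x $ i2) (y $ i2) (z $ i2) (x $ i3) (y $ i3) (z $ i3) = 0"
    for i1 i2 i3
    by (subst det3_transpose) (rule coord)
  have 2: "det3 (f1 x) (f1 y) (f1 z) (x $ i2) (y $ i2) (z $ i2) (x $ i3) (y $ i3) (z $ i3) = 0" for i2 i3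
    unfolding e[OF f(1), of x] e[OF f(1), of y] e[OF f(1), of z] by (rule det3_linear_combination) (rule 1)
  have 3: "det3 (f1 x) (f1 y) (f1 z) (f2 x) (f2 y) (f2 z) (x $ i3) (y $ i3) (z $ i3) = 0" for i3
    unfolding e[OF f(2), of x] e[OF f(2), of y] e[OF f(2), of z] by (rule det3_linear_combination2) (rule 2)
  have "det3 (f1 x) (f1 y) (f1 z) (f2 x) (f2 y) (f2 z) (f3 x) (f3 y) (f3 z) = 0"
    unfolding e[OF f(3), of x] e[OF f(3), of y] e[OF f(3), of z] by (rule det3_linear_combination3) (rule 3)
  then show ?thesis by (subst det3_transpose)
qed

lemma matrix_power_vector: "matrix_power P r *v u = (((*v) P) ^^ r) u"
  by (induction r) (simp_all add: matrix_vector_mul_assoc[symmetric])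

text \<open>\<open>N c\<close> stands for the Jacobian matrix at the point \<open>c\<close>; the
  index \<open>None\<close> carries its constant part and \<open>Some k\<close> the coefficient of
  the variable \<open>k\<close>, recovered from \<open>bilinear_part\<close> at a unit
  vector.\<close>

lemma jointly_nilpotent_if_symmetric:
  fixes A0 :: "'a::field^'n^'n" and A :: "'n \<Rightarrow> 'a^'n^'n"
  assumes inf: "infinite (UNIV :: 'a set)"
    and sym: "\<And>i j k. A k $ i $ j = A j $ i $ k"
    and N: "\<And>c v. N c *v v = A0 *v v + bilinear_part A c v"
    and nil: "\<And>c. nilpotent_matrix (N c)"
    and minors: "\<And>c i1 i2 i3 j1 j2 j3. det3 (N c $ i1 $ j1) (N c $ i1 $ j2) (N c $ i1 $ j3)
      (N c $ i2 $ j1) (N c $ i2 $ j2) (N c $ i2 $ j3) (N c $ i3 $ j1) (N c $ i3 $ j2) (N c $ i3 $ j3) = 0"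
  shows "jointly_nilpotent (case_option A0 A)"
proof -
  interpret F: infinite_field_space "(*s) :: 'a \<Rightarrow> 'a^'n \<Rightarrow> 'a^'n"
    by unfold_locales (use inf in \<open>auto simp: vector_scalar_mult_def vec_eq_iff algebra_simps\<close>)
  have "quadratic_family (*s) ((*v) A0) (bilinear_part A)"
  proof (rule F.quadratic_familyI)
    show "bilinear_part A x (u + v) = bilinear_part A x u + bilinear_part A x v" for x u v
      by (simp add: bilinear_part_def matrix_vector_right_distrib vec.scale_right_distrib sum.distrib)
    show "bilinear_part A x (c *s u) = c *s bilinear_part A x u" for x c u
      by (simp add: bilinear_part_def vec.scale vec.scale_sum_right mult.commute)
    show "bilinear_part A x y = bilinear_part A y x" for x y by (rule bilinear_part_sym[OF sym])
    show "\<exists>r. ((\<lambda>u. A0 *v u + bilinear_part A x u) ^^ r) u = 0" for x u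
    proof -
      obtain r where r: "matrix_power (N x) r = 0" using nil by (auto simp: nilpotent_matrix_def)
      have "(\<lambda>u. A0 *v u + bilinear_part A x u) = (*v) (N x)" by (simp add: fun_eq_iff N)
      then show ?thesis using matrix_power_vector[of "N x" r u] r by auto
    qed
    show "F.dep3 (A0 *v u1 + bilinear_part A x u1) (A0 *v u2 + bilinear_part A x u2)
      (A0 *v u3 + bilinear_part A x u3)" for x u1 u2 u3
      unfolding F.dep3_def N[symmetric]
      by (intro allI impI, rule det3_functionals[OF det3_rows[OF minors]])
  qed (simp_all add: matrix_vector_right_distrib vec.scale)
  then interpret Q: quadratic_family "(*s)" "(*v) A0" "bilinear_part A" .
  show ?thesis
  proof (rule jointly_nilpotent_if_step)
    fix W :: "('a^'n) set"
    assume W: "vec.subspace W" "W \<noteq> UNIV"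
      and inv: "\<And>i w. w \<in> W \<Longrightarrow> case_option A0 A i *v w \<in> W"
    have "A0 *v w \<in> W" if "w \<in> W" for w using inv[OF that, of None] by simp
    moreover have "bilinear_part A x w \<in> W" if "w \<in> W" for x w
      unfolding bilinear_part_def using inv[OF that, of "Some _"]
      by (intro vec.subspace_sum[OF W(1)] vec.subspace_scale[OF W(1)]) simp
    ultimately obtain v where v: "v \<notin> W" "A0 *v v \<in> W" "\<And>x. bilinear_part A x v \<in> W"
      using Q.invariant_subspace_step[OF W] by metis
    have "case_option A0 A i *v v \<in> W" for i
      using v(2) v(3)[of "axis k 1" for k] by (cases i) (simp_all add: bilinear_part_axis)
    then show "\<exists>v. v \<notin> W \<and> (\<forall>i. case_option A0 A i *v v \<in> W)" using v(1) by blast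
  qed
qed


subsection \<open>Evaluation of polynomials and the coefficients of the Jacobian matrix\<close>

locale field_embedding =
  fixes \<phi> :: "'a::field \<Rightarrow> 'b::field"
  assumes hom_add: "\<phi> (a + b) = \<phi> a + \<phi> b" and hom_mult: "\<phi> (a * b) = \<phi> a * \<phi> b"
    and hom_one: "\<phi> 1 = 1"
begin

lemma hom_zero: "\<phi> 0 = 0"
  using hom_add[of 0 0] by (metis add_cancel_left_left add_0)

lemma hom_sum: "\<phi> (sum f S) = (\<Sum>i\<in>S. \<phi> (f i))"
  by (induction S rule: infinite_finite_induct) (simp_all add: hom_zero hom_add)

lemma hom_eq_0: "\<phi> a = 0 \<longleftrightarrow> a = 0"
proof
  assume "\<phi> a = 0"
  show "a = 0"
  proof (rule ccontr)
    assume "a \<noteq> 0"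
    then have "\<phi> a * \<phi> (inverse a) = 1" by (simp add: hom_mult[symmetric] hom_one)
    then show False using \<open>\<phi> a = 0\<close> by simp
  qed
qed (simp add: hom_zero)

definition eval :: "('n \<Rightarrow> 'b) \<Rightarrow> ('n::finite, 'a) mpoly \<Rightarrow> 'b" where
  "eval c p = (\<Sum>m\<in>Poly_Mapping.keys p.
     \<phi> (Poly_Mapping.lookup p m) * (\<Prod>i\<in>UNIV. c i ^ Poly_Mapping.lookup m i))"

lemma eval_superset:
  assumes "finite S" "Poly_Mapping.keys p \<subseteq> S"
  shows "eval c p = (\<Sum>m\<in>S. \<phi> (Poly_Mapping.lookup p m) * (\<Prod>i\<in>UNIV. c i ^ Poly_Mapping.lookup m i))"
  unfolding eval_def
  by (rule sum.mono_neutral_left[OF assms]) (simp add: in_keys_iff hom_zero)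

lemma eval_zero [simp]: "eval c 0 = 0"
  by (simp add: eval_def)

lemma eval_add: "eval c (p + q) = eval c p + eval c q"
proof -
  let ?S = "Poly_Mapping.keys p \<union> Poly_Mapping.keys q"
  have "Poly_Mapping.keys (p + q) \<subseteq> ?S" by (rule keys_add)
  then show ?thesis
    using eval_superset[of ?S "p + q" c] eval_superset[of ?S p c] eval_superset[of ?S q c]
    by (simp add: lookup_add hom_add distrib_right sum.distrib)
qed

lemma eval_sum: "eval c (sum f S) = (\<Sum>i\<in>S. eval c (f i))"
  by (induction S rule: infinite_finite_induct) (simp_all add: eval_add)

lemma eval_diff: "eval c (p - q) = eval c p - eval c q"
  using eval_add[of c "p - q" q] by simp

lemma eval_single:
  "eval c (Poly_Mapping.single m a) = \<phi> a * (\<Prod>i\<in>UNIV. c i ^ Poly_Mapping.lookup m i)"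
  using eval_superset[of "{m}" "Poly_Mapping.single m a" c] by simp

lemma eval_one [simp]: "eval c 1 = 1"
  using eval_single[of c 0 1] by (simp add: hom_one)

lemma poly_mapping_as_sum:
  "(\<Sum>m\<in>Poly_Mapping.keys p. Poly_Mapping.single m (Poly_Mapping.lookup p m)) = p"
  by (rule poly_mapping_eqI)
    (auto simp: lookup_sum lookup_single when_def in_keys_iff if_distrib cong: if_cong)

lemma eval_mult: "eval c (p * q) = eval c p * eval c q"
proof -
  have "p * q = (\<Sum>m\<in>Poly_Mapping.keys p. Poly_Mapping.single m (Poly_Mapping.lookup p m)) *
    (\<Sum>m\<in>Poly_Mapping.keys q. Poly_Mapping.single m (Poly_Mapping.lookup q m))"
    by (simp add: poly_mapping_as_sum)
  also have "\<dots> = (\<Sum>m\<in>Poly_Mapping.keys p. \<Sum>m'\<in>Poly_Mapping.keys q.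
    Poly_Mapping.single (m + m') (Poly_Mapping.lookup p m * Poly_Mapping.lookup q m'))"
    by (simp add: sum_product mult_single)
  finally have "eval c (p * q) = (\<Sum>m\<in>Poly_Mapping.keys p. \<Sum>m'\<in>Poly_Mapping.keys q.
      \<phi> (Poly_Mapping.lookup p m) * \<phi> (Poly_Mapping.lookup q m') *
      ((\<Prod>i\<in>UNIV. c i ^ Poly_Mapping.lookup m i) * (\<Prod>i\<in>UNIV. c i ^ Poly_Mapping.lookup m' i)))"
    by (simp add: eval_sum eval_single hom_mult lookup_add power_add prod.distrib)
  then show ?thesis by (simp add: eval_def sum_product ac_simps)
qed

lemma eval_matrix_power:
  fixes M :: "(('n::finite, 'a) mpoly)^'m^'m"
  shows "map_matrix (eval c) (matrix_power M r) = matrix_power (map_matrix (eval c) M) r"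
proof (induction r)
  case 0
  show ?case by (simp add: vec_eq_iff mat_def)
next
  case (Suc r)
  have "map_matrix (eval c) (M ** N) = map_matrix (eval c) M ** map_matrix (eval c) N"
    for N :: "(('n, 'a) mpoly)^'m^'m"
    by (simp add: vec_eq_iff matrix_matrix_mult_def eval_sum eval_mult)
  then show ?case by (simp add: Suc)
qed

lemma eval_affine:
  fixes p :: "('n::finite, 'a) mpoly"
  assumes "\<And>m. Poly_Mapping.lookup p m \<noteq> 0 \<Longrightarrow> m = 0 \<or> (\<exists>k. m = Poly_Mapping.single k 1)"
  shows "eval c p = \<phi> (Poly_Mapping.lookup p 0) +
    (\<Sum>k\<in>UNIV. c k * \<phi> (Poly_Mapping.lookup p (Poly_Mapping.single k 1)))"
proof -
  let ?e = "\<lambda>k :: 'n. Poly_Mapping.single k (1 :: nat)"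
  have inj: "inj ?e"
    by (rule injI) (metis lookup_single_eq lookup_single_not_eq zero_neq_one)
  have mon: "(\<Prod>i\<in>UNIV. c i ^ Poly_Mapping.lookup (?e k) i) = c k" for k
  proof -
    have "(\<Prod>i\<in>UNIV. c i ^ Poly_Mapping.lookup (?e k) i) = (\<Prod>i\<in>UNIV. if i = k then c i else 1)"
      by (rule prod.cong) (auto simp: lookup_single when_def)
    then show ?thesis by simp
  qed
  have "?e k \<noteq> 0" for k
    using lookup_single_eq[of k "1 :: nat"] by (auto simp del: lookup_single_eq)
  then have "0 \<notin> range ?e" by auto
  moreover have "Poly_Mapping.keys p \<subseteq> insert 0 (range ?e)" using assms by (auto simp: in_keys_iff)
  ultimately show ?thesis
    using eval_superset[of "insert 0 (range ?e)" p c]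
    by (simp add: sum.reindex[OF inj, simplified] mon[simplified] mult.commute)
qed

end

section \<open>Coefficients of partial derivatives\<close>

lemma lookup_partial_deriv:
  "Poly_Mapping.lookup (partial_deriv j p) m =
    of_nat (Suc (Poly_Mapping.lookup m j)) * Poly_Mapping.lookup p (m + Poly_Mapping.single j 1)"
proof -
  let ?e = "Poly_Mapping.single j (1 :: nat)"
  have shift: "m' - ?e = m \<longleftrightarrow> m' = m + ?e" if "Poly_Mapping.lookup m' j \<noteq> 0" for m'
  proof
    assume m: "m' - ?e = m"
    show "m' = m + ?e"
    proof (rule poly_mapping_eqI)
      fix i
      show "Poly_Mapping.lookup m' i = Poly_Mapping.lookup (m + ?e) i"
        using that by (cases "i = j") (auto simp: m[symmetric] lookup_add lookup_minus lookup_single when_def)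
    qed
  qed simp
  have "Poly_Mapping.lookup (partial_deriv j p) m = (\<Sum>m'\<in>Poly_Mapping.keys p.
      if m' = m + ?e then of_nat (Poly_Mapping.lookup m' j) * Poly_Mapping.lookup p m' else 0)"
    unfolding partial_deriv_def lookup_sum
  proof (rule sum.cong)
    fix m'
    show "Poly_Mapping.lookup (Poly_Mapping.single (m' - ?e)
        (of_nat (Poly_Mapping.lookup m' j) * Poly_Mapping.lookup p m')) m =
      (if m' = m + ?e then of_nat (Poly_Mapping.lookup m' j) * Poly_Mapping.lookup p m' else 0)"
      using shift[of m'] by (cases "Poly_Mapping.lookup m' j = 0") (auto simp: lookup_single when_def)
  qed simp
  also have "\<dots> = of_nat (Suc (Poly_Mapping.lookup m j)) * Poly_Mapping.lookup p (m + ?e)"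
    by (simp add: lookup_add in_keys_iff)
  finally show ?thesis .
qed

text \<open>For \<open>j \<noteq> k\<close> both sides are the coefficient of the product of the two
  variables in \<open>p\<close>, with factor 1. Hence the symmetry holds in characteristic 2 as
  well.\<close>

lemma lookup_partial_deriv_sym:
  "Poly_Mapping.lookup (partial_deriv j p) (Poly_Mapping.single k 1) =
    Poly_Mapping.lookup (partial_deriv k p) (Poly_Mapping.single j 1)"
proof -
  have "Poly_Mapping.lookup (Poly_Mapping.single k (1 :: nat)) j =
    Poly_Mapping.lookup (Poly_Mapping.single j (1 :: nat)) k"
    by (simp add: lookup_single when_def)
  then show ?thesis by (simp add: lookup_partial_deriv add.commute)
qed

lemma monom_degree_add: "monom_degree (m + m') = monom_degree m + monom_degree m'"
  by (simp add: monom_degree_def lookup_add sum.distrib)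

lemma monom_degree_single: "monom_degree (Poly_Mapping.single k a) = a"
proof -
  have "monom_degree (Poly_Mapping.single k a) = (\<Sum>i\<in>UNIV. if i = k then a else 0)"
    unfolding monom_degree_def by (rule sum.cong) (auto simp: lookup_single when_def)
  then show ?thesis by simp
qed

lemma monom_degree_le_1:
  assumes "monom_degree m \<le> 1"
  shows "m = 0 \<or> (\<exists>k. m = Poly_Mapping.single k 1)"
proof (rule disjCI)
  assume neg: "\<nexists>k. m = Poly_Mapping.single k 1"
  show "m = 0"
  proof (rule ccontr)
    assume "m \<noteq> 0"
    then obtain k where k: "Poly_Mapping.lookup m k \<noteq> 0"
      by (metis lookup_zero poly_mapping_eqI)
    define m' where "m' = m - Poly_Mapping.single k 1"
    have m: "m = m' + Poly_Mapping.single k 1"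
      by (rule poly_mapping_eqI) (use k in \<open>auto simp: m'_def lookup_add lookup_minus lookup_single when_def\<close>)
    then have "monom_degree m' = 0"
      using assms by (simp add: monom_degree_add monom_degree_single)
    then have "m' = 0" by (intro poly_mapping_eqI) (simp add: monom_degree_def)
    then have "m = Poly_Mapping.single k 1" using m by simp
    then show False using neg by blast
  qed
qed

lemma jacobian_affine:
  assumes deg: "map_degree H \<le> 2"
    and nz: "Poly_Mapping.lookup (jacobian_matrix H $ i $ j) m \<noteq> 0"
  shows "m = 0 \<or> (\<exists>k. m = Poly_Mapping.single k 1)"
proof -
  have "m + Poly_Mapping.single j 1 \<in> Poly_Mapping.keys (H $ i)"
    using nz by (auto simp: jacobian_matrix_def lookup_partial_deriv in_keys_iff)
  then have "monom_degree (m + Poly_Mapping.single j 1) \<le> total_degree (H $ i)"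
    unfolding total_degree_def by (intro Max_ge) auto
  also have "\<dots> \<le> map_degree H"
    unfolding map_degree_def by (intro Max_ge) auto
  finally show ?thesis
    using deg by (intro monom_degree_le_1) (simp add: monom_degree_add monom_degree_single)
qed

section \<open>Minors, coefficient matrices and the theorem\<close>

lemma det3_eq_0_if_rank_le_2:
  fixes G :: "'a::field^'n^'m"
  assumes "rank G \<le> 2"
  shows "det3 (G $ i1 $ j1) (G $ i1 $ j2) (G $ i1 $ j3) (G $ i2 $ j1) (G $ i2 $ j2) (G $ i2 $ j3)
    (G $ i3 $ j1) (G $ i3 $ j2) (G $ i3 $ j3) = 0"
proof -
  consider "G $ i1 = 0" | "G $ i2 \<in> vec.span {G $ i1}" | "G $ i3 \<in> vec.span {G $ i2, G $ i1}"
    | "G $ i1 \<noteq> 0" "G $ i2 \<notin> vec.span {G $ i1}" "G $ i3 \<notin> vec.span {G $ i2, G $ i1}" by blast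
  then show ?thesis
  proof cases
    case 2
    then obtain c where "G $ i2 = c *s G $ i1" by (auto simp: vec.span_singleton)
    then show ?thesis by (simp add: det3_def algebra_simps)
  next
    case 3
    then obtain c where "G $ i3 - c *s G $ i2 \<in> vec.span {G $ i1}" by (auto simp: vec.span_breakdown_eq)
    then obtain d where "G $ i3 - c *s G $ i2 = d *s G $ i1" by (auto simp: vec.span_singleton)
    then have "G $ i3 = c *s G $ i2 + d *s G $ i1" by (simp add: algebra_simps)
    then show ?thesis by (simp add: det3_def algebra_simps)
  next
    case 4
    have "vec.independent {G $ i3, G $ i2, G $ i1}"
      using 4 by (intro vec.independent_insertI) (auto simp: vec.independent_empty)
    moreover have "{G $ i3, G $ i2, G $ i1} \<subseteq> rows G" by (auto simp: rows_def row_def)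
    ultimately have "card {G $ i3, G $ i2, G $ i1} \<le> rank G"
      unfolding row_rank_def_gen by (intro vec.independent_card_le_dim)
    moreover have "card {G $ i3, G $ i2, G $ i1} = 3"
      using 4 by (auto simp: card_insert_if vec.span_base)
    ultimately show ?thesis using assms by simp
  qed (simp add: det3_def)
qed

lemma det3_eq_0_if_fract_rank_le_2:
  fixes G :: "'r::idom^'n^'m"
  assumes "fract_rank G \<le> 2"
  shows "det3 (G $ i1 $ j1) (G $ i1 $ j2) (G $ i1 $ j3) (G $ i2 $ j1) (G $ i2 $ j2) (G $ i2 $ j3)
    (G $ i3 $ j1) (G $ i3 $ j2) (G $ i3 $ j3) = 0"
    (is "?d = 0")
proof -
  have "Fract ?d 1 = 0"
    using det3_eq_0_if_rank_le_2[OF assms[unfolded fract_rank_def], of i1 j1 j2 j3 i2 i3]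
    by (simp add: det3_def)
  then show ?thesis by (simp add: Zero_fract_def eq_fract)
qed

text \<open>Conjugation by constant matrices acts on each coefficient matrix separately, so one
  \<open>T\<close> that triangularizes all of them triangularizes the polynomial matrix.\<close>

definition coeff_matrix :: "(('n, 'a::zero) mpoly)^'m^'k \<Rightarrow> ('n \<Rightarrow>\<^sub>0 nat) \<Rightarrow> 'a^'m^'k" where
  "coeff_matrix M m = (\<chi> i j. Poly_Mapping.lookup (M $ i $ j) m)"

lemma lookup_Const_mult: "Poly_Mapping.lookup (Const c * p) m = c * Poly_Mapping.lookup p m"
  for c :: "'a::comm_ring_1"
  by (simp add: Const_def mult_map_scale_conv_mult[symmetric] Poly_Mapping.map.rep_eq when_def)

lemma lookup_mult_Const: "Poly_Mapping.lookup (p * Const c) m = Poly_Mapping.lookup p m * c"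
  for c :: "'a::comm_ring_1"
  by (metis lookup_Const_mult mult.commute)

lemma coeff_matrix_conjugate:
  fixes M :: "(('n::finite, 'a::comm_ring_1) mpoly)^'n^'n"
  shows "coeff_matrix (map_matrix Const S ** M ** map_matrix Const T) m = S ** coeff_matrix M m ** T"
  by (simp add: vec_eq_iff coeff_matrix_def matrix_matrix_mult_def lookup_sum sum_distrib_right
      lookup_Const_mult lookup_mult_Const)

definition embed :: "'a::field \<Rightarrow> 'a poly fract" where
  "embed c = Fract [:c:] 1"

lemma embed: "field_embedding embed"
  by unfold_locales (simp_all add: embed_def One_fract_def one_pCons mult.commute)

lemma infinite_poly_fract: "infinite (UNIV :: 'a::field poly fract set)"
proof -
  have "inj (\<lambda>n. Fract (monom (1 :: 'a) n) 1)"
    by (auto simp: inj_on_def eq_fract monom_eq_iff')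
  then show ?thesis using finite_subset[OF subset_UNIV] range_inj_infinite by blast
qed

theorem theorem3p2:
  fixes H :: "(('n::{finite,linorder}, 'a::field) mpoly)^('n::{finite,linorder})"
  assumes "map_degree H \<le> 2"
    and "fract_rank (jacobian_matrix H) \<le> 2"
    and "nilpotent_matrix (jacobian_matrix H)"
  shows "\<exists>M. similar_over_base (jacobian_matrix H) M \<and> triangular_matrix M"
proof -
  interpret field_embedding "embed :: 'a \<Rightarrow> 'a poly fract" by (rule embed)
  let ?J = "jacobian_matrix H"
  let ?h = "map_matrix embed"
  define A where "A = case_option (coeff_matrix ?J 0) (\<lambda>k. coeff_matrix ?J (Poly_Mapping.single k 1))"
  have A_simps: "A None = coeff_matrix ?J 0" "A (Some k) = coeff_matrix ?J (Poly_Mapping.single k 1)" for k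
    by (simp_all add: A_def)
  \<comment> \<open>Evaluation at points over the larger field is a ring homomorphism, so nilpotency
    and vanishing minors carry over to every \<open>N c\<close>.\<close>
  define N where "N c = map_matrix (eval (\<lambda>k. c $ k)) ?J" for c :: "('a poly fract, 'n) vec"
  obtain r where r: "r \<ge> 1" "matrix_power ?J r = 0" using assms(3) by (auto simp: nilpotent_matrix_def)
  have "jointly_nilpotent (case_option (?h (A None)) (\<lambda>k. ?h (A (Some k))))"
  proof (rule jointly_nilpotent_if_symmetric[where N = N, OF infinite_poly_fract])
    show "?h (A (Some k)) $ i $ j = ?h (A (Some j)) $ i $ k" for i j k
      by (simp add: A_simps coeff_matrix_def jacobian_matrix_def lookup_partial_deriv_sym[of j _ k, simplified])
    show "N c *v v = ?h (A None) *v v + bilinear_part (\<lambda>k. ?h (A (Some k))) c v" for c v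
    proof -
      have e: "N c $ i $ j = ?h (A None) $ i $ j + (\<Sum>k\<in>UNIV. c $ k * ?h (A (Some k)) $ i $ j)" for i j
        unfolding N_def A_simps coeff_matrix_def nth_map_matrix vec_lambda_beta
        by (rule eval_affine) (rule jacobian_affine[OF assms(1)])
      have "(\<Sum>j\<in>UNIV. (\<Sum>k\<in>UNIV. c $ k * ?h (A (Some k)) $ i $ j) * v $ j) =
        (\<Sum>k\<in>UNIV. c $ k * (\<Sum>j\<in>UNIV. ?h (A (Some k)) $ i $ j * v $ j))" for i
        unfolding sum_distrib_left sum_distrib_right mult.assoc by (rule sum.swap)
      then show ?thesis
        by (simp add: vec_eq_iff matrix_vector_mult_def bilinear_part_def e distrib_right sum.distrib
            del: nth_map_matrix)
    qed
    show "nilpotent_matrix (N c)" for c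
    proof -
      have "matrix_power (N c) r = 0"
        unfolding N_def eval_matrix_power[symmetric] r(2) by (simp add: vec_eq_iff)
      then show ?thesis using r(1) by (auto simp: nilpotent_matrix_def)
    qed
    show "det3 (N c $ i1 $ j1) (N c $ i1 $ j2) (N c $ i1 $ j3)
      (N c $ i2 $ j1) (N c $ i2 $ j2) (N c $ i2 $ j3) (N c $ i3 $ j1) (N c $ i3 $ j2) (N c $ i3 $ j3) = 0"
      for c i1 i2 i3 j1 j2 j3
      using arg_cong[OF det3_eq_0_if_fract_rank_le_2[OF assms(2), of i1 j1 j2 j3 i2 i3],
          of "eval (\<lambda>k. c $ k)"]
      by (simp add: N_def det3_def eval_add eval_diff eval_mult)
  qed
  moreover have "case_option (?h (A None)) (\<lambda>k. ?h (A (Some k))) = (\<lambda>i. ?h (A i))"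
    by (auto simp: fun_eq_iff split: option.split)
  ultimately have nil: "jointly_nilpotent (\<lambda>i. ?h (A i))" by simp
  \<comment> \<open>This is the descent: words in matrices over \<open>K\<close> applied to vectors
    over \<open>K\<close> stay over \<open>K\<close>, and \<open>embed\<close> is injective.\<close>
  have word: "word_apply (\<lambda>i. ?h (A i)) ws (\<chi> i. embed (v $ i)) = (\<chi> i. embed (word_apply A ws v $ i))"
    for ws v
    by (induction ws) (simp_all add: vec_eq_iff matrix_vector_mult_def hom_sum hom_mult)
  have nilA: "jointly_nilpotent A"
    unfolding jointly_nilpotent_def
  proof
    fix v
    obtain m where "\<And>ws. m \<le> length ws \<Longrightarrow> word_apply (\<lambda>i. ?h (A i)) ws (\<chi> i. embed (v $ i)) = 0"
      using nil unfolding jointly_nilpotent_def by blast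
    then have "word_apply A ws v = 0" if "m \<le> length ws" for ws
      using that by (simp add: word vec_eq_iff hom_eq_0)
    then show "\<exists>m. \<forall>ws. m \<le> length ws \<longrightarrow> word_apply A ws v = 0" by blast
  qed
  from triangularize[OF nilA] obtain T :: "(('a, 'n) vec, 'n) vec" where T: "invertible T"
    "\<forall>i r c. c \<le> r \<longrightarrow> (matrix_inv T ** A i ** T) $ r $ c = 0"
    by (elim exE conjE)
  define M where "M = map_matrix Const (matrix_inv T) ** ?J ** map_matrix Const T"
  have "Poly_Mapping.lookup (M $ i $ j) m = 0" if "j < i" for i j m
  proof -
    \<comment> \<open>A map of degree at most two has no further nonzero coefficient matrices than
      those collected in \<open>A\<close>.\<close>
    have "coeff_matrix ?J m = 0 \<or> m = 0 \<or> (\<exists>k. m = Poly_Mapping.single k 1)"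
      using jacobian_affine[OF assms(1)] by (auto simp: vec_eq_iff coeff_matrix_def)
    then have "coeff_matrix ?J m = 0 \<or> (\<exists>k. coeff_matrix ?J m = A k)"
      using A_simps by metis
    then have "(matrix_inv T ** coeff_matrix ?J m ** T) $ i $ j = 0"
      using T(2) that by auto
    then have "coeff_matrix M m $ i $ j = 0"
      by (simp add: M_def coeff_matrix_conjugate)
    then show ?thesis by (simp add: coeff_matrix_def)
  qed
  then have "upper_triangular_matrix M"
    by (auto simp: upper_triangular_matrix_def intro!: poly_mapping_eqI)
  moreover have "similar_over_base ?J M"
    unfolding similar_over_base_def M_def using T(1) by (intro exI[of _ T] conjI refl)
  ultimately show ?thesis unfolding triangular_matrix_def by (intro exI[of _ M]) simp
qed

end
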